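(* Let $0<t_0<T$, let $p_2$ be the law on $\mathbb{R}^D$ of $x=A_2z_2+\varepsilon_2$, where $A_2\in\mathbb{R}^{D\times d_2}$ satisfies $A_2^\top A_2=I_{d_2}$, $z_2\sim p_{2,z}$ is a random vector in $\mathbb{R}^{d_2}$, and $\varepsilon_2\sim\mathcal{N}(0,\sigma_2^2I_D)$ is independent of $z_2$, with $\sigma_2>0$. Assume: (i) the density $p_{2,z}>0$ is twice continuously differentiable, and there are constants $B_2,C_{1,2},C_{2,2}>0$ such that $p_{2,z}(z)\le(2\pi)^{-d_2/2}C_{1,2}\exp\{-C_{2,2}\|z\|_2^2/2\}$ for all $\|z\|_2\ge B_2$; (ii) the map $f_2^*(z,t):=\widetilde h_2(t)\nabla\log p_{2,t}^{\rm LD}(z)+z$ is $\beta_2$-Lipschitz in $z\in\mathbb{R}^{d_2}$, uniformly over $t\in[0,T]$. Let $V_1\in\mathbb{R}^{D\times d_1}$ with $V_1^\top V_1=I_{d_1}$, $B:=V_1^\top A_2$, $r=\min\{d_1,d_2\}$, and let $\theta_1,\dots,\theta_r\in[0,\pi/2]$ be the principal angles between $\operatorname{col}(V_1)$ and $\operatorname{col}(A_2)$ (so the singular values of $B$ are $\cos\theta_j$). Let $g_2(y,t):=h(t)\nabla\log p_{2,t}^{\rm LD}(y)+y$, let $L_g(t)$ be a Lipschitz constant of $g_2(\cdot,t)$, and, for $X_t\sim p_{2,t}$ and $Y_t:=A_2^\top X_t$, let $$\lambda_{g,2}^{\max}(t):=\lambda_{\max}\big(\mathbb{E}[g_2(Y_t,t)g_2(Y_t,t)^\top]\big),\qquad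 M_{Y,2}(t):=\mathbb{E}[Y_tY_t^\top].$$ Let $\mathcal{U}_{\rm comp}(V_1)$ be the comparator risk defined in the context. If $d_1\ge d_2$ and $B$ has full column rank, then $$\mathcal{U}_{\rm comp}(V_1)\le\frac{1}{T-t_0}\int_{t_0}^T\Bigg[\frac{\lambda_{g,2}^{\max}(t)}{h^2(t)}\sum_{j=1}^{d_2}\sin^2\theta_j+\frac{2\|B\|_{\rm op}^2\widetilde h_2(t)L_g^2(t)}{h^2(t)}\sum_{j=1}^{d_2}\tan^2\theta_j+\frac{\sigma_2^4\alpha^4(t)}{h^2(t)\widetilde h_2(t)}\Big(D+d_1-d_2-\sum_{j=1}^{d_2}\cos^2\theta_j\Big)\Bigg]\mathrm{d}t .$$ If $d_1<d_2$ and $B$ has full row rank, then $$\begin{aligned}\mathcal{U}_{\rm comp}(V_1)\le\frac{1}{T-t_0}\int_{t_0}^T\Bigg[&\frac{\lambda_{g,2}^{\max}(t)}{h^2(t)}\Big(d_2-\sum_{j=1}^{d_1}\cos^2\theta_j\Big)+\frac{2\|B\|_{\rm op}^2L_g^2(t)}{h^2(t)}\operatorname{Tr}\big((I_{d_2}-B^\dagger B)M_{Y,2}(t)\big)\\&+\frac{2\|B\|_{\rm op}^2\widetilde h_2(t)L_g^2(t)}{h^2(t)}\sum_{j=1}^{d_1}\tan^2\theta_j+\frac{\sigma_2^4\alpha^4(t)}{h^2(t)\widetilde h_2(t)}\Big(D+d_1-d_2-\sum_{j=1}^{d_1}\cos^2\theta_j\Big)\Bigg]\mathrm{d}t .\e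nd{aligned}$$
   Context: Forward process: $\alpha(t)=e^{-t/2}$, $h(t)=1-e^{-t}$, and $X_t\mid X_0\sim\mathcal{N}(\alpha(t)X_0,h(t)I_D)$. When $X_0\sim p_2$, $p_{2,t}$ denotes the density of $X_t$. Set $\widetilde h_2(t)=\alpha^2(t)\sigma_2^2+h(t)$, and for $y\in\mathbb{R}^{d_2}$ let $p_{2,t}^{\rm LD}(y)=\int_{\mathbb{R}^{d_2}}\phi_{2,t}(y\mid z)p_{2,z}(z)\,\mathrm{d}z$, where $\phi_{2,t}(\cdot\mid z)$ is the density of $\mathcal{N}(\alpha(t)z,\widetilde h_2(t)I_{d_2})$. $B^\dagger$ denotes the Moore–Penrose pseudoinverse and $\|\cdot\|_{\rm op}$ the operator norm. Comparator: $f_{\rm comp}(z,t):=B\,g_2(B^\dagger z,t)$ for $z\in\mathbb{R}^{d_1}$, $s_{\rm comp}(x,t):=\frac{1}{h(t)}V_1f_{\rm comp}(V_1^\top x,t)-\frac{1}{h(t)}x$, and $\mathcal{U}_{\rm comp}(V_1):=\mathcal{L}_2(s_{\rm comp})$, where $$\mathcal{L}_2(s)=\frac{1}{T-t_0}\int_{t_0}^T\mathbb{E}_{X_t\sim p_{2,t}}\|s(X_t,t)-\nabla\log p_{2,t}(X_t)\|_2^2\,\mathrm{d}t.$$ *)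

theory Defs
  imports "HOL-Probability.Probability"
begin

section \<open>Gradients and smoothness\<close>

definition grad :: "('a::real_inner \<Rightarrow> real) \<Rightarrow> 'a \<Rightarrow> 'a" where
  "grad f x = (THE D. GDERIV f x :> D)"

definition twice_cont_differentiable :: "(real ^ 'n \<Rightarrow> real) \<Rightarrow> bool" where
  "twice_cont_differentiable f \<longleftrightarrow>
     (\<exists>G H :: real ^ 'n \<Rightarrow> _. (\<forall>x. GDERIV f x :> G x) \<and>
        (\<forall>x. (G has_derivative (\<lambda>v. H x *v v)) (at x)) \<and> continuous_on UNIV H)"


section \<open>Matrices\<close>

definition outer :: "real ^ 'm \<Rightarrow> real ^ 'n \<Rightarrow> real ^ 'n ^ 'm" where
  "outer u v = (\<chi> i j. u $ i * v $ j)"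

definition eigenvalues :: "real ^ 'n ^ 'n \<Rightarrow> real set" where
  "eigenvalues M = {l. \<exists>v. v \<noteq> 0 \<and> M *v v = l *\<^sub>R v}"

text \<open>Only used for symmetric matrices, which have a nonempty finite set of real eigenvalues.\<close>

definition lambda_max :: "real ^ 'n ^ 'n \<Rightarrow> real" where
  "lambda_max M = Max (eigenvalues M)"

definition is_pinv :: "real ^ 'n ^ 'm \<Rightarrow> real ^ 'm ^ 'n \<Rightarrow> bool" where
  "is_pinv A P \<longleftrightarrow> A ** P ** A = A \<and> P ** A ** P = P \<and>
     transpose (A ** P) = A ** P \<and> transpose (P ** A) = P ** A"

definition pinv :: "real ^ 'n ^ 'm \<Rightarrow> real ^ 'm ^ 'n" where
  "pinv A = (THE P. is_pinv A P)"

abbreviation op_norm :: "real ^ 'n ^ 'm \<Rightarrow> real" where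
  "op_norm A \<equiv> onorm ((*v) A)"

definition col_space :: "real ^ 'n ^ 'm \<Rightarrow> (real ^ 'm) set" where
  "col_space A = span (columns A)"

text \<open>
  Principal angles between subspaces, by the successive maximisation
  \<open>cos \<theta>\<^sub>j = max {x \<bullet> y}\<close> over unit vectors \<open>x \<in> U\<close>, \<open>y \<in> W\<close> orthogonal to the
  principal vectors chosen before. The angles are indexed from 1, in increasing order;
  values of \<open>\<theta>\<close> at other indices are unconstrained.
\<close>

definition principal_angles ::
    "'a::euclidean_space set \<Rightarrow> 'a set \<Rightarrow> (nat \<Rightarrow> real) \<Rightarrow> bool" where
  "principal_angles U W \<theta> \<longleftrightarrow>
     (\<exists>u w. \<forall>j\<in>{1..min (dim U) (dim W)}.
        \<theta> j \<in> {0..pi / 2} \<and> cos (\<theta> j) = u j \<bullet> w j \<and>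
        u j \<in> U \<and> norm (u j) = 1 \<and> (\<forall>i\<in>{1..<j}. u i \<bullet> u j = 0) \<and>
        w j \<in> W \<and> norm (w j) = 1 \<and> (\<forall>i\<in>{1..<j}. w i \<bullet> w j = 0) \<and>
        (\<forall>x\<in>U. \<forall>y\<in>W. norm x = 1 \<longrightarrow> norm y = 1 \<longrightarrow>
           (\<forall>i\<in>{1..<j}. u i \<bullet> x = 0 \<and> w i \<bullet> y = 0) \<longrightarrow> x \<bullet> y \<le> u j \<bullet> w j))"


section \<open>Gaussians and the forward process\<close>

text \<open>Density at \<open>x\<close> of \<open>N(m, v I)\<close>; the second argument is the variance.\<close>

definition gauss_density :: "real ^ 'n \<Rightarrow> real \<Rightarrow> real ^ 'n \<Rightarrow> real" where
  "gauss_density m v x = exp (- (norm (x - m))\<^sup>2 / (2 * v)) / sqrt (2 * pi * v) ^ CARD('n)"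

definition fwd_alpha :: "real \<Rightarrow> real" where
  "fwd_alpha t = exp (- t / 2)"

definition fwd_h :: "real \<Rightarrow> real" where
  "fwd_h t = 1 - exp (- t)"

text \<open>
  For \<open>X\<^sub>0\<close> of law \<open>P\<close> and \<open>t > 0\<close>: the (everywhere positive, smooth) density of \<open>X\<^sub>t\<close>, i.e. the
  \<open>P\<close>-mixture of the transition densities. See \<open>emeasure_fwd_law\<close>.
\<close>

definition fwd_density :: "(real ^ 'n) measure \<Rightarrow> real \<Rightarrow> real ^ 'n \<Rightarrow> real" where
  "fwd_density P t x = (\<integral>x0. gauss_density (fwd_alpha t *\<^sub>R x0) (fwd_h t) x \<partial>P)"

definition fwd_law :: "(real ^ 'n) measure \<Rightarrow> real \<Rightarrow> (real ^ 'n) measure" where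
  "fwd_law P t = density lborel (\<lambda>x. ennreal (fwd_density P t x))"

lemma gauss_density_nonneg: "v \<ge> 0 \<Longrightarrow> 0 \<le> gauss_density m v x"
  by (simp add: gauss_density_def)

lemma gauss_density_measurable [measurable]:
  assumes [measurable]: "f \<in> borel_measurable M" "g \<in> borel_measurable M"
  shows "(\<lambda>\<omega>. gauss_density (f \<omega>) v (g \<omega>)) \<in> borel_measurable M"
  unfolding gauss_density_def by measurable

lemma emeasure_fwd_law:
  fixes P :: "(real ^ 'n) measure"
  assumes "prob_space P" and [measurable_cong]: "sets P = sets borel" and t: "0 < t"
    and [measurable]: "S \<in> sets borel"
  shows "emeasure (fwd_law P t) S =
    (\<integral>\<^sup>+x0. emeasure (density lborel
       (\<lambda>x. ennreal (gauss_density (fwd_alpha t *\<^sub>R x0) (fwd_h t) x))) S \<partial>P)"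
proof -
  interpret prob_space P by fact
  have h: "fwd_h t > 0" using t by (simp add: fwd_h_def)
  let ?k = "\<lambda>x0 x. gauss_density (fwd_alpha t *\<^sub>R x0) (fwd_h t) x :: real"
  have nn: "0 \<le> ?k x0 x" for x0 x :: "real ^ 'n"
    using h by (intro gauss_density_nonneg) simp
  have bd: "?k x0 x \<le> 1 / sqrt (2 * pi * fwd_h t) ^ CARD('n)" for x0 x :: "real ^ 'n"
    unfolding gauss_density_def using h by (intro divide_right_mono) auto
  have int: "integrable P (\<lambda>x0. ?k x0 x)" for x
    by (rule integrable_const_bound[where B = "1 / sqrt (2 * pi * fwd_h t) ^ CARD('n)"])
       (use bd nn in \<open>auto simp: abs_of_nonneg\<close>)
  have eq: "ennreal (fwd_density P t x) = (\<integral>\<^sup>+x0. ennreal (?k x0 x) \<partial>P)" for x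
    unfolding fwd_density_def
    by (rule nn_integral_eq_integral[symmetric])
       (use int nn in auto)
  have sf: "pair_sigma_finite P (lborel :: (real ^ 'n) measure)"
    by (intro pair_sigma_finite.intro) (unfold_locales)
  have mf: "(\<lambda>x. \<integral>\<^sup>+x0. ennreal (?k x0 x) \<partial>P) \<in> borel_measurable lborel"
    by measurable
  have "emeasure (fwd_law P t) S = (\<integral>\<^sup>+x. (\<integral>\<^sup>+x0. ennreal (?k x0 x) \<partial>P) * indicator S x \<partial>lborel)"
    unfolding fwd_law_def eq using mf by (simp add: emeasure_density)
  also have "\<dots> = (\<integral>\<^sup>+x. \<integral>\<^sup>+x0. ennreal (?k x0 x) * indicator S x \<partial>P \<partial>lborel)"
    by (simp add: nn_integral_multc)
  also have "\<dots> = (\<integral>\<^sup>+x0. \<integral>\<^sup>+x. ennreal (?k x0 x) * indicator S x \<partial>lborel \<partial>P)"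
    by (rule pair_sigma_finite.Fubini'[OF sf]) measurable
  finally show ?thesis
    by (simp add: emeasure_density)
qed

definition second_moment :: "'a measure \<Rightarrow> ('a \<Rightarrow> real ^ 'n) \<Rightarrow> real ^ 'n ^ 'n" where
  "second_moment \<mu> f = (\<integral>x. outer (f x) (f x) \<partial>\<mu>)"

text \<open>Integrated as a nonnegative quantity, so that an infinite risk is not collapsed to 0.\<close>

definition score_risk ::
    "(real ^ 'n) measure \<Rightarrow> real \<Rightarrow> real \<Rightarrow> (real ^ 'n \<Rightarrow> real \<Rightarrow> real ^ 'n) \<Rightarrow> ennreal" where
  "score_risk P t0 T s =
     ennreal (1 / (T - t0)) *
       (\<integral>\<^sup>+t\<in>{t0..T}.
          (\<integral>\<^sup>+x. ennreal ((norm (s x t - grad (\<lambda>u. ln (fwd_density P t u)) x))\<^sup>2) \<partial>fwd_law P t)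
        \<partial>lborel)"


section \<open>Latent densities and the comparator score\<close>

text \<open>Below, \<open>\<sigma>\<close> is the noise standard deviation and \<open>p\<close> the latent density.\<close>

definition htilde :: "real \<Rightarrow> real \<Rightarrow> real" where
  "htilde \<sigma> t = (fwd_alpha t)\<^sup>2 * \<sigma>\<^sup>2 + fwd_h t"

definition latent_density :: "real \<Rightarrow> (real ^ 'k \<Rightarrow> real) \<Rightarrow> real \<Rightarrow> real ^ 'k \<Rightarrow> real" where
  "latent_density \<sigma> p t y = (\<integral>z. gauss_density (fwd_alpha t *\<^sub>R z) (htilde \<sigma> t) y * p z \<partial>lborel)"

definition latent_score :: "real \<Rightarrow> (real ^ 'k \<Rightarrow> real) \<Rightarrow> real \<Rightarrow> real ^ 'k \<Rightarrow> real ^ 'k" where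
  "latent_score \<sigma> p t = grad (\<lambda>u. ln (latent_density \<sigma> p t u))"

definition f_star :: "real \<Rightarrow> (real ^ 'k \<Rightarrow> real) \<Rightarrow> real ^ 'k \<Rightarrow> real \<Rightarrow> real ^ 'k" where
  "f_star \<sigma> p z t = htilde \<sigma> t *\<^sub>R latent_score \<sigma> p t z + z"

definition g_map :: "real \<Rightarrow> (real ^ 'k \<Rightarrow> real) \<Rightarrow> real ^ 'k \<Rightarrow> real \<Rightarrow> real ^ 'k" where
  "g_map \<sigma> p y t = fwd_h t *\<^sub>R latent_score \<sigma> p t y + y"

definition f_comp ::
    "real \<Rightarrow> (real ^ 'k \<Rightarrow> real) \<Rightarrow> real ^ 'k ^ 'l \<Rightarrow> real ^ 'l \<Rightarrow> real \<Rightarrow> real ^ 'l" where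
  "f_comp \<sigma> p B z t = B *v g_map \<sigma> p (pinv B *v z) t"

definition s_comp ::
    "real \<Rightarrow> (real ^ 'k \<Rightarrow> real) \<Rightarrow> real ^ 'k ^ 'n \<Rightarrow> real ^ 'l ^ 'n \<Rightarrow> real ^ 'n \<Rightarrow> real \<Rightarrow> real ^ 'n"
  where
  "s_comp \<sigma> p A V x t =
     (1 / fwd_h t) *\<^sub>R (V *v f_comp \<sigma> p (transpose V ** A) (transpose V *v x) t)
       - (1 / fwd_h t) *\<^sub>R x"

definition U_comp ::
    "(real ^ 'n) measure \<Rightarrow> real \<Rightarrow> real \<Rightarrow> real \<Rightarrow> (real ^ 'k \<Rightarrow> real) \<Rightarrow> real ^ 'k ^ 'n \<Rightarrow>
     real ^ 'l ^ 'n \<Rightarrow> ennreal" where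
  "U_comp P t0 T \<sigma> p A V = score_risk P t0 T (s_comp \<sigma> p A V)"

end

(*
  Write y = A2^T x and xi = x - A2 y for x drawn from the forward law. The score of the forward law
  splits into the latent score at y and a linear term in xi, so h times the error of the comparator
  score equals
    V1 (B (g(u) - g(y)) - c V1^T xi) - (I - V1 V1^T) (A2 g(y) + c xi),
    u = B^+ V1^T x,  c = alpha^2 sigma^2 / htilde,
  where the two summands are orthogonal. The forward law is invariant under the reflection
  xi |-> -xi, which kills the cross term between g(y) and xi, and the projection of xi to any
  direction w orthogonal to col(A2) has variance htilde |w|^2. What remains are traces, which are
  evaluated in the singular basis of B provided by the principal vectors.
*)
theory Submission
  imports Defs
begin

text \<open>The factors 2 come from the part of the error inside col(V1): there u itself depends on
  xi, so B (g(u) - g(y)) and c V1^T xi need not be orthogonal in mean, and they are separated by the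
  parallelogram inequality. Outside col(V1) a function of y alone meets xi, so that square expands
  without loss. Hence |V1^T xi|^2 enters with weight 2 and |(I - V1 V1^T) xi|^2 with weight 1;
  together they average to E|xi|^2 + E|V1^T xi|^2 = htilde (D - d2 + d1 - sum cos^2), the last
  bracket of the theorem.

  The error u - y has two orthogonal pieces. One is the component of y in the kernel of B, which the
  comparator cannot see; it gives the trace term. The other is B^+ V1^T xi, whose coefficient along
  the j-th right singular vector is noise of variance htilde sin^2 divided by cos^2; it gives the
  tan^2 sum.

  The constant c equals 1 - h / htilde: \<open>g_map\<close> weights the latent score by h, whereas
  the linear part of the true score carries 1 / htilde.\<close>

declare transpose_matrix_vector [simp del]

section \<open>Isotropic Gaussians\<close>

lemma nn_integral_lborel_translate:
  fixes f :: "'a::euclidean_space \<Rightarrow> ennreal"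
  assumes [measurable]: "f \<in> borel_measurable borel"
  shows "(\<integral>\<^sup>+x. f (c + x) \<partial>lborel) = (\<integral>\<^sup>+x. f x \<partial>lborel)"
  by (subst (2) lborel_distr_plus[of c, symmetric]) (simp add: nn_integral_distr)

lemma nn_integral_lborel_uminus:
  fixes f :: "'a::euclidean_space \<Rightarrow> ennreal"
  assumes [measurable]: "f \<in> borel_measurable borel"
  shows "(\<integral>\<^sup>+x. f (- x) \<partial>lborel) = (\<integral>\<^sup>+x. f x \<partial>lborel)"
  by (subst (2) lborel_affine[of "-1" 0]) (simp_all add: nn_integral_distr density_1)

text \<open>A translation-invariant measure is a multiple of Lebesgue measure, and the unit ball,
  which \<open>f\<close> preserves, fixes the multiple at 1. The proof is the Fubini form of this
  uniqueness argument: the double integral of the ball's indicator at \<open>x\<close> times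
  \<open>g (f y + x)\<close> is evaluated in both orders.\<close>

lemma nn_integral_lborel_orthogonal:
  fixes f :: "'a::euclidean_space \<Rightarrow> 'a" and g :: "'a \<Rightarrow> ennreal"
  assumes f: "orthogonal_transformation f" and g[measurable]: "g \<in> borel_measurable borel"
  shows "(\<integral>\<^sup>+x. g (f x) \<partial>lborel) = (\<integral>\<^sup>+x. g x \<partial>lborel)"
proof -
  have lin: "linear f" using f by (rule orthogonal_transformation_linear)
  have [measurable]: "f \<in> borel_measurable borel"
    using lin by (intro borel_measurable_continuous_onI linear_continuous_on linear_conv_bounded_linear[THEN iffD1])
  let ?B = "indicator (ball 0 1) :: 'a \<Rightarrow> ennreal"
  let ?c = "emeasure lborel (ball (0::'a) 1)"
  have [measurable]: "?B \<in> borel_measurable borel" by (intro borel_measurable_indicator) simp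
  have c: "?c = (\<integral>\<^sup>+x. ?B x \<partial>lborel)" by simp
  \<comment> \<open>A shift by \<open>x\<close> outside \<open>f\<close> is a shift by a preimage of
    \<open>x\<close> inside \<open>f\<close>, so it leaves the integral over \<open>y\<close>
    alone.\<close>
  have tr: "(\<integral>\<^sup>+y. g (f y + x) \<partial>lborel) = (\<integral>\<^sup>+y. g (f y) \<partial>lborel)" for x
  proof -
    obtain z where z: "f z = x" using orthogonal_transformation_surj[OF f] by (metis surjD)
    have "(\<integral>\<^sup>+y. g (f y + x) \<partial>lborel) = (\<integral>\<^sup>+y. g (f (z + y)) \<partial>lborel)"
      using z by (simp add: linear_add[OF lin] add.commute)
    also have "\<dots> = (\<integral>\<^sup>+y. g (f y) \<partial>lborel)"
      by (intro nn_integral_lborel_translate) simp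
    finally show ?thesis .
  qed
  have ball: "(\<integral>\<^sup>+y. ?B (x - f y) \<partial>lborel) = ?c" for x
  proof -
    obtain z where z: "f z = x" using orthogonal_transformation_surj[OF f] by (metis surjD)
    have "(\<integral>\<^sup>+y. ?B (x - f y) \<partial>lborel) = (\<integral>\<^sup>+y. ?B (z - y) \<partial>lborel)"
      using z[symmetric] orthogonal_transformation_norm[OF f]
      by (simp add: linear_diff[OF lin, symmetric] indicator_def)
    also have "\<dots> = (\<integral>\<^sup>+y. ?B (z + y) \<partial>lborel)"
      using nn_integral_lborel_uminus[of "\<lambda>y. ?B (z + y)"] by simp
    also have "\<dots> = ?c" unfolding c by (rule nn_integral_lborel_translate) simp
    finally show ?thesis .
  qed
  have "?c * (\<integral>\<^sup>+y. g (f y) \<partial>lborel) = (\<integral>\<^sup>+x. ?B x * (\<integral>\<^sup>+y. g (f y) \<partial>lborel) \<partial>lborel)"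
    by (simp add: nn_integral_multc)
  also have "\<dots> = (\<integral>\<^sup>+x. (\<integral>\<^sup>+y. ?B x * g (f y + x) \<partial>lborel) \<partial>lborel)"
    by (simp add: tr nn_integral_cmult)
  also have "\<dots> = (\<integral>\<^sup>+y. (\<integral>\<^sup>+x. ?B x * g (f y + x) \<partial>lborel) \<partial>lborel)"
    by (rule lborel_pair.Fubini') simp
  \<comment> \<open>Substituting \<open>x - f y\<close> for \<open>x\<close> moves the dependence on
    \<open>y\<close> from \<open>g\<close> to the ball, where \<open>ball\<close> integrates it
    out.\<close>
  also have "\<dots> = (\<integral>\<^sup>+y. (\<integral>\<^sup>+x. ?B (x - f y) * g x \<partial>lborel) \<partial>lborel)"
  proof (rule nn_integral_cong)
    fix y show "(\<integral>\<^sup>+x. ?B x * g (f y + x) \<partial>lborel) = (\<integral>\<^sup>+x. ?B (x - f y) * g x \<partial>lborel)"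
      using nn_integral_lborel_translate[of "\<lambda>x. ?B (x - f y) * g x" "f y"] by simp
  qed
  also have "\<dots> = (\<integral>\<^sup>+x. (\<integral>\<^sup>+y. ?B (x - f y) * g x \<partial>lborel) \<partial>lborel)"
    by (rule lborel_pair.Fubini') simp
  also have "\<dots> = ?c * (\<integral>\<^sup>+x. g x \<partial>lborel)"
    by (simp add: nn_integral_multc ball nn_integral_cmult)
  finally have eq: "?c * (\<integral>\<^sup>+y. g (f y) \<partial>lborel) = ?c * (\<integral>\<^sup>+x. g x \<partial>lborel)" .
  have "?c \<noteq> 0" "?c \<noteq> \<infinity>"
    using emeasure_lborel_ball_finite[of "0::'a" 1] content_ball_pos[of 1 "0::'a"]
    by (auto simp: measure_def)
  then show ?thesis using eq by (simp add: ennreal_mult_cancel_left)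
qed

section \<open>Mass, second moments and convolution of isotropic Gaussians\<close>

lemma gauss_density_prod:
  fixes x m :: "real^'n"
  assumes "v > 0"
  shows "gauss_density m v x = (\<Prod>b\<in>Basis. normal_density (m \<bullet> b) (sqrt v) (x \<bullet> b))"
proof -
  have "(norm (x - m))\<^sup>2 = (\<Sum>b\<in>Basis. (x \<bullet> b - m \<bullet> b)\<^sup>2)"
    unfolding power2_norm_eq_inner euclidean_inner[of "x-m" "x-m"]
    by (simp add: inner_diff_left power2_eq_square)
  then have "exp (- (norm (x - m))\<^sup>2 / (2 * v)) = (\<Prod>b\<in>Basis. exp (- (x \<bullet> b - m \<bullet> b)\<^sup>2 / (2 * v)))"
    by (simp add: exp_sum[symmetric] sum_negf sum_divide_distrib)
  then show ?thesis
    using assms by (simp add: gauss_density_def normal_density_def prod_dividef)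
qed

lemma gauss_density_pos: "v > 0 \<Longrightarrow> 0 < gauss_density m v x"
  by (simp add: gauss_density_def)

lemma gauss_density_translate: "gauss_density m v (m + x) = gauss_density 0 v x"
  by (simp add: gauss_density_def)

lemma gauss_density_orthogonal:
  fixes f :: "real^'n \<Rightarrow> real^'n"
  assumes "orthogonal_transformation f"
  shows "gauss_density 0 v (f x) = gauss_density 0 v x"
  using orthogonal_transformation_norm[OF assms] by (simp add: gauss_density_def)

lemma nn_integral_normal_density:
  "s > 0 \<Longrightarrow> (\<integral>\<^sup>+x. ennreal (normal_density \<mu> s x) \<partial>lborel) = 1"
  by (subst nn_integral_eq_integral) auto

lemma nn_integral_normal_second_moment:
  assumes "s > 0"
  shows "(\<integral>\<^sup>+x. ennreal (normal_density 0 s x * x\<^sup>2) \<partial>lborel) = ennreal (s\<^sup>2)"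
proof -
  have "has_bochner_integral lborel (\<lambda>x. normal_density 0 s x * x\<^sup>2) (s\<^sup>2)"
    using normal_moment_even[OF assms, of 0 1] assms by (simp add: fact_numeral power2_eq_square)
  then show ?thesis
    by (simp add: nn_integral_eq_integral has_bochner_integral_iff)
qed

lemma nn_integral_gauss_density:
  fixes m :: "real^'n"
  assumes v: "v > 0"
  shows "(\<integral>\<^sup>+x. ennreal (gauss_density m v x) \<partial>lborel) = 1"
proof -
  have "(\<integral>\<^sup>+x. ennreal (gauss_density m v x) \<partial>lborel) =
     (\<integral>\<^sup>+x. (\<Prod>b\<in>Basis. ennreal (normal_density (m \<bullet> b) (sqrt v) (x \<bullet> b))) \<partial>lborel)"
    by (simp add: gauss_density_prod[OF v] prod_ennreal)
  also have "\<dots> = 1"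
    by (subst nn_integral_lborel_prod) (use v in \<open>auto simp: nn_integral_normal_density\<close>)
  finally show ?thesis .
qed

text \<open>By rotation invariance \<open>w\<close> may be taken to be \<open>norm w\<close> times a
  coordinate axis. The integral then factors over the coordinates: one factor is a one-dimensional
  variance, all others are total masses.\<close>

lemma nn_integral_gauss_second_moment:
  fixes w :: "real^'n"
  assumes v: "v > 0"
  shows "(\<integral>\<^sup>+x. ennreal (gauss_density 0 v x * (w \<bullet> x)\<^sup>2) \<partial>lborel) = ennreal (v * (norm w)\<^sup>2)"
proof -
  obtain k :: 'n where True by simp
  let ?e = "axis k 1 :: real^'n"
  have e: "?e \<in> Basis" by (auto simp: Basis_vec_def)
  obtain f where f: "orthogonal_transformation f" "f (norm w *\<^sub>R ?e) = w"
    by (rule orthogonal_transformation_exists[of "norm w *\<^sub>R ?e" w]) (simp add: norm_axis_1)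
  let ?F = "\<lambda>b u. ennreal (normal_density 0 (sqrt v) u * (if b = ?e then u\<^sup>2 else 1))"
  have "(\<integral>\<^sup>+x. ennreal (gauss_density 0 v x * (w \<bullet> x)\<^sup>2) \<partial>lborel)
     = (\<integral>\<^sup>+x. ennreal (gauss_density 0 v (f x) * (w \<bullet> f x)\<^sup>2) \<partial>lborel)"
    by (rule nn_integral_lborel_orthogonal[symmetric]) (use f in auto)
  also have "\<dots> = (\<integral>\<^sup>+x. ennreal (gauss_density 0 v x * ((norm w *\<^sub>R ?e) \<bullet> x)\<^sup>2) \<partial>lborel)"
  proof -
    have "w \<bullet> f x = (norm w *\<^sub>R ?e) \<bullet> x" for x
      using f unfolding orthogonal_transformation_def by metis
    then show ?thesis by (simp add: gauss_density_orthogonal[OF f(1)])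
  qed
  also have "\<dots> = (\<integral>\<^sup>+x. ennreal ((norm w)\<^sup>2) * ennreal (gauss_density 0 v x * (x \<bullet> ?e)\<^sup>2) \<partial>lborel)"
    by (simp add: ennreal_mult'[symmetric] power_mult_distrib ac_simps inner_commute)
  also have "\<dots> = ennreal ((norm w)\<^sup>2) * (\<integral>\<^sup>+x. ennreal (gauss_density 0 v x * (x \<bullet> ?e)\<^sup>2) \<partial>lborel)"
    by (rule nn_integral_cmult) simp
  also have "(\<integral>\<^sup>+x. ennreal (gauss_density 0 v x * (x \<bullet> ?e)\<^sup>2) \<partial>lborel)
     = (\<integral>\<^sup>+x. (\<Prod>b\<in>Basis. ?F b (x \<bullet> b)) \<partial>lborel)"
  proof (intro nn_integral_cong)
    fix x :: "real^'n"
    have "(\<Prod>b\<in>Basis. if b = ?e then (x \<bullet> b)\<^sup>2 else 1) = (x \<bullet> ?e)\<^sup>2"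
      using e by (simp add: prod.delta)
    then show "ennreal (gauss_density 0 v x * (x \<bullet> ?e)\<^sup>2) = (\<Prod>b\<in>Basis. ?F b (x \<bullet> b))"
      by (subst prod_ennreal) (auto simp: gauss_density_prod[OF v] prod.distrib)
  qed
  also have "\<dots> = (\<Prod>b\<in>(Basis::(real^'n) set). \<integral>\<^sup>+u. ?F b u \<partial>lborel)"
    by (rule nn_integral_lborel_prod) auto
  also have "\<dots> = (\<Prod>b\<in>(Basis::(real^'n) set). if b = ?e then ennreal v else 1)"
    using v by (intro prod.cong) (auto simp: nn_integral_normal_density nn_integral_normal_second_moment)
  also have "\<dots> = ennreal v" using e by (simp add: prod.delta)
  finally show ?thesis using v by (simp add: ennreal_mult'[symmetric] mult.commute)
qed

lemma nn_integral_gauss_norm2: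
  assumes v: "v > 0"
  shows "(\<integral>\<^sup>+x. ennreal (gauss_density 0 v x * (norm (x :: real^'n))\<^sup>2) \<partial>lborel) = ennreal (v * CARD('n))"
proof -
  have "(\<integral>\<^sup>+x. ennreal (gauss_density 0 v x * (norm (x :: real^'n))\<^sup>2) \<partial>lborel)
     = (\<integral>\<^sup>+x. (\<Sum>b\<in>Basis. ennreal (gauss_density 0 v x * (b \<bullet> (x :: real^'n))\<^sup>2)) \<partial>lborel)"
  proof (intro nn_integral_cong)
    fix x :: "real^'n"
    have "(norm x)\<^sup>2 = (\<Sum>b\<in>Basis. (b \<bullet> x)\<^sup>2)"
      unfolding power2_norm_eq_inner euclidean_inner[of x x]
      by (simp add: power2_eq_square inner_commute)
    then show "ennreal (gauss_density 0 v x * (norm x)\<^sup>2)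
       = (\<Sum>b\<in>Basis. ennreal (gauss_density 0 v x * (b \<bullet> x)\<^sup>2))"
      using v by (simp add: sum_distrib_left gauss_density_nonneg)
  qed
  also have "\<dots> = (\<Sum>b\<in>(Basis::(real^'n) set). ennreal v)"
    using v by (subst nn_integral_sum) (auto simp: nn_integral_gauss_second_moment)
  finally show ?thesis using v by (simp add: ennreal_of_nat_eq_real_of_nat ennreal_mult' mult.commute)
qed

text \<open>Completing the square in \<open>e\<close>: the mean of \<open>e\<close> given \<open>x\<close> is \<open>(a s / (a\<^sup>2 s + h)) (x - m)\<close>,
  its variance is \<open>s h / (a\<^sup>2 s + h)\<close>.\<close>

lemma nn_integral_gauss_convolution:
  fixes x m :: "real^'n"
  assumes h: "h > 0" and s: "s > 0"
  shows "(\<integral>\<^sup>+e. ennreal (gauss_density (m + a *\<^sub>R e) h x) * ennreal (gauss_density 0 s e) \<partial>lborel)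
    = ennreal (gauss_density m (a\<^sup>2 * s + h) x)"
proof -
  define k where "k = a\<^sup>2 * s + h"
  have k: "k > 0" using h s unfolding k_def by (simp add: add_nonneg_pos)
  define e0 where "e0 = (a * s / k) *\<^sub>R (x - m)"
  have sq: "(norm (x - (m + a *\<^sub>R e)))\<^sup>2 / (2*h) + (norm e)\<^sup>2 / (2 * s)
     = (norm (x - m))\<^sup>2 / (2*k) + (norm (e - e0))\<^sup>2 / (2 * (s * h/k))" for e
  proof -
    define X where "X = x - m"
    have 1: "(norm (x - (m + a *\<^sub>R e)))\<^sup>2 = X\<bullet>X - 2*a*(X\<bullet>e) + a\<^sup>2*(e\<bullet>e)"
      unfolding X_def power2_norm_eq_inner
      by (simp add: inner_diff_left inner_diff_right inner_add_left
          inner_add_right inner_commute algebra_simps power2_eq_square)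
    have 2: "(norm (e - e0))\<^sup>2 = e\<bullet>e - 2*(a * s/k)*(X\<bullet>e) + (a * s/k)\<^sup>2*(X\<bullet>X)"
      unfolding e0_def X_def[symmetric] 
      unfolding power2_norm_eq_inner
      by (simp add: inner_diff_left inner_diff_right inner_commute
        algebra_simps power2_eq_square)
    \<comment> \<open>The vectors enter only through the scalars \<open>X \<bullet> X\<close>,
      \<open>X \<bullet> e\<close> and \<open>e \<bullet> e\<close>, here \<open>p\<close>,
      \<open>q\<close> and \<open>r\<close>, so completing the square is an identity of real
      fractions.\<close>
    have "(p - 2*a*q + a\<^sup>2*r) / (2*h) + r / (2 * s) = p / (2*k) + (r - 2*(a * s/k)*q + (a * s/k)\<^sup>2*p) / (2 * (s * h/k))" for p q r
    proof -
      have "(r - 2*(a * s/k)*q + (a * s/k)\<^sup>2*p) / (2 * (s * h/k)) = (k * r - 2*a * s*q + a\<^sup>2 * s\<^sup>2*p/k) / (2 * s * h)"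
        using h s k by (simp add: field_simps power2_eq_square)
      also have "p / (2*k) + \<dots> = (k * r - 2*a * s*q + ((s * h + a\<^sup>2 * s\<^sup>2)/k)*p) / (2 * s * h)"
        using h s k by (simp add: field_simps)
      also have "(s * h + a\<^sup>2 * s\<^sup>2)/k = s"
        using k by (simp add: field_simps) (simp add: k_def algebra_simps power2_eq_square)
      also have "(k * r - 2*a * s*q + s * p) / (2 * s * h) = (p - 2*a*q + a\<^sup>2*r) / (2*h) + r / (2 * s)"
        using h s by (simp add: k_def field_simps)
      finally show ?thesis ..
    qed
    from this[of "X\<bullet>X" "X\<bullet>e" "e\<bullet>e"] show ?thesis
      unfolding 1 2 unfolding power2_norm_eq_inner X_def .
  qed
  have shk: "s * h / k > 0" using h s k by simp
  \<comment> \<open>The normalising constants agree because the two variances on either side have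
    the same product, \<open>h * s\<close>.\<close>
  have pre: "sqrt (2*pi*h) ^ CARD('n) * sqrt (2*pi* s) ^ CARD('n)
     = sqrt (2*pi*k) ^ CARD('n) * sqrt (2*pi*(s * h/k)) ^ CARD('n)"
    using k by (simp only: power_mult_distrib[symmetric] real_sqrt_mult[symmetric]) (simp add: field_simps)
  have eq: "gauss_density (m + a *\<^sub>R e) h x * gauss_density 0 s e = gauss_density m k x * gauss_density e0 (s * h/k) e" for e
  proof -
    have "exp (- (norm (x - (m + a *\<^sub>R e)))\<^sup>2 / (2*h)) * exp (- (norm e)\<^sup>2 / (2 * s))
      = exp (- (norm (x - m))\<^sup>2 / (2*k)) * exp (- (norm (e - e0))\<^sup>2 / (2 * (s * h/k)))"
      using sq[of e] by (simp add: exp_add[symmetric] del: times_divide_eq_right)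
    then show ?thesis unfolding gauss_density_def diff_zero times_divide_times_eq pre by simp
  qed
  show ?thesis unfolding k_def[symmetric]
    by (simp add: ennreal_mult'[symmetric] gauss_density_nonneg h s k less_imp_le eq)
       (simp add: ennreal_mult' gauss_density_nonneg k less_imp_le nn_integral_cmult nn_integral_gauss_density[OF shk])
qed

section \<open>The forward law as a Gaussian mixture\<close>

lemma fwd_h_pos: "t > 0 \<Longrightarrow> fwd_h t > 0"
  by (simp add: fwd_h_def)

lemma fwd_alpha_pos: "fwd_alpha t > 0"
  by (simp add: fwd_alpha_def)

lemma htilde_pos: "t > 0 \<Longrightarrow> htilde \<sigma> t > 0"
  unfolding htilde_def using fwd_h_pos[of t] by (simp add: add_nonneg_pos)

text \<open>The library's \<open>indep_var\<close> requires both variables to have the same type.\<close>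

lemma (in prob_space) distr_pair_indep_set:
  fixes X :: "'a \<Rightarrow> 'b::euclidean_space" and Y :: "'a \<Rightarrow> 'c::euclidean_space"
  assumes [measurable]: "X \<in> borel_measurable M" "Y \<in> borel_measurable M"
    and ind: "indep_set {X -` S \<inter> space M | S. S \<in> sets borel} {Y -` S \<inter> space M | S. S \<in> sets borel}"
  shows "distr M borel X \<Otimes>\<^sub>M distr M borel Y = distr M (borel \<Otimes>\<^sub>M borel) (\<lambda>\<omega>. (X \<omega>, Y \<omega>))"
proof -
  interpret X: prob_space "distr M borel X" by (rule prob_space_distr) simp
  interpret Y: prob_space "distr M borel Y" by (rule prob_space_distr) simp
  show ?thesis
  proof (rule pair_measure_eqI)
    fix S T assume "S \<in> sets (distr M borel X)" "T \<in> sets (distr M borel Y)"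
    then have ST [measurable]: "S \<in> sets borel" "T \<in> sets borel" by auto
    have "(\<lambda>\<omega>. (X \<omega>, Y \<omega>)) -` (S \<times> T) \<inter> space M = (X -` S \<inter> space M) \<inter> (Y -` T \<inter> space M)" by auto
    moreover have "prob ((X -` S \<inter> space M) \<inter> (Y -` T \<inter> space M)) = prob (X -` S \<inter> space M) * prob (Y -` T \<inter> space M)"
      using ST by (intro indep_setD[OF ind]) auto
    ultimately show "emeasure (distr M borel X) S * emeasure (distr M borel Y) T
       = emeasure (distr M (borel \<Otimes>\<^sub>M borel) (\<lambda>\<omega>. (X \<omega>, Y \<omega>))) (S \<times> T)"
      by (simp add: emeasure_distr emeasure_eq_measure ennreal_mult'[symmetric])
  qed (auto intro: X.sigma_finite_measure_axioms Y.sigma_finite_measure_axioms cong: sets_pair_measure_cong)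
qed

lemma borel_measurable_of_ennreal:
  fixes f :: "'a \<Rightarrow> real"
  assumes [measurable]: "(\<lambda>x. ennreal (f x)) \<in> borel_measurable M" and "\<And>x. 0 \<le> f x"
  shows "f \<in> borel_measurable M"
proof -
  have "(\<lambda>x. enn2real (ennreal (f x))) \<in> borel_measurable M" by measurable
  then show ?thesis using assms(2) by simp
qed

lemma matrix_vector_mult_measurable [measurable (raw)]:
  fixes A :: "real^'n^'m"
  assumes [measurable]: "f \<in> borel_measurable M"
  shows "(\<lambda>x. A *v f x) \<in> borel_measurable M"
  by (rule measurable_compose[OF assms])
     (intro borel_measurable_continuous_onI linear_continuous_on matrix_vector_mul_bounded_linear)

text \<open>The noise contributed by \<open>X\<^sub>0\<close> and by the forward process add up to one isotropic Gaussian.\<close>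

lemma fwd_density_eq_mixture:
  fixes z2 :: "'w \<Rightarrow> real^'d" and eps2 :: "'w \<Rightarrow> real^'n" and A :: "real^'d^'n"
  assumes M: "prob_space M"
    and z2: "distributed M lborel z2 (\<lambda>z. ennreal (p z))"
    and eps2: "distributed M lborel eps2 (\<lambda>x. ennreal (gauss_density 0 (\<sigma>\<^sup>2) x))"
    and indep: "prob_space.indep_set M
          {z2 -` S \<inter> space M | S. S \<in> sets borel} {eps2 -` S \<inter> space M | S. S \<in> sets borel}"
    and \<sigma>: "\<sigma> > 0" and t: "t > 0"
  shows "ennreal (fwd_density (distr M borel (\<lambda>\<omega>. A *v z2 \<omega> + eps2 \<omega>)) t x) =
    (\<integral>\<^sup>+z. ennreal (p z) * ennreal (gauss_density (fwd_alpha t *\<^sub>R (A *v z)) (htilde \<sigma> t) x) \<partial>lborel)"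
proof -
  interpret prob_space M by fact
  have h: "fwd_h t > 0" using t by (rule fwd_h_pos)
  have [measurable]: "z2 \<in> borel_measurable M" "eps2 \<in> borel_measurable M"
    using z2 eps2 by (auto dest: distributed_measurable)
  have [measurable]: "(\<lambda>z. ennreal (p z)) \<in> borel_measurable borel"
    using distributed_borel_measurable[OF z2] by simp
  let ?k = "\<lambda>x0. gauss_density (fwd_alpha t *\<^sub>R x0) (fwd_h t) x"
  have nn: "0 \<le> ?k x0" for x0 using h by (intro gauss_density_nonneg) simp
  have bd: "?k x0 \<le> 1 / sqrt (2 * pi * fwd_h t) ^ CARD('n)" for x0
    unfolding gauss_density_def using h by (intro divide_right_mono) auto
  have dz: "distr M borel z2 = density lborel (\<lambda>z. ennreal (p z))"
    and de: "distr M borel eps2 = density lborel (\<lambda>x. ennreal (gauss_density 0 (\<sigma>\<^sup>2) x))"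
    using distributed_distr_eq_density[OF z2] distributed_distr_eq_density[OF eps2]
    by (simp_all cong: distr_cong)
  interpret E: prob_space "distr M borel eps2" by (rule prob_space_distr) simp
  \<comment> \<open>\<open>fwd_density\<close> is a Bochner integral; boundedness of the transition
    density makes it a genuine one, so that it may be exchanged for a nonnegative integral.\<close>
  have int: "integrable M (\<lambda>\<omega>. ?k (A *v z2 \<omega> + eps2 \<omega>))"
    by (rule integrable_const_bound[where B = "1 / sqrt (2 * pi * fwd_h t) ^ CARD('n)"])
       (use bd nn in \<open>auto simp: abs_of_nonneg\<close>)
  have "ennreal (fwd_density (distr M borel (\<lambda>\<omega>. A *v z2 \<omega> + eps2 \<omega>)) t x)
    = (\<integral>\<^sup>+\<omega>. ennreal (?k (A *v z2 \<omega> + eps2 \<omega>)) \<partial>M)"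
    unfolding fwd_density_def using int nn
    by (subst integral_distr) (auto simp: nn_integral_eq_integral)
  also have "\<dots> = (\<integral>\<^sup>+(z,e). ennreal (?k (A *v z + e)) \<partial>(distr M borel z2 \<Otimes>\<^sub>M distr M borel eps2))"
    unfolding distr_pair_indep_set[OF \<open>z2 \<in> _\<close> \<open>eps2 \<in> _\<close> indep] by (subst nn_integral_distr) auto
  also have "\<dots> = (\<integral>\<^sup>+z. \<integral>\<^sup>+e. ennreal (?k (A *v z + e)) \<partial>distr M borel eps2 \<partial>distr M borel z2)"
    by (subst E.nn_integral_fst[symmetric]) auto
  also have "\<dots> = (\<integral>\<^sup>+z. ennreal (p z) * (\<integral>\<^sup>+e. ennreal (gauss_density 0 (\<sigma>\<^sup>2) e) * ennreal (?k (A *v z + e)) \<partial>lborel) \<partial>lborel)"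
    unfolding dz de by (simp add: nn_integral_density)
  also have "\<dots> = (\<integral>\<^sup>+z. ennreal (p z) * (\<integral>\<^sup>+e. ennreal (gauss_density (fwd_alpha t *\<^sub>R (A *v z) + fwd_alpha t *\<^sub>R e) (fwd_h t) x) * ennreal (gauss_density 0 (\<sigma>\<^sup>2) e) \<partial>lborel) \<partial>lborel)"
    by (simp add: ac_simps scaleR_add_right)
  also have "\<dots> = (\<integral>\<^sup>+z. ennreal (p z) * ennreal (gauss_density (fwd_alpha t *\<^sub>R (A *v z)) (htilde \<sigma> t) x) \<partial>lborel)"
    using h \<sigma> by (subst nn_integral_gauss_convolution) (auto simp: htilde_def)
  finally show ?thesis .
qed

text \<open>The random variables of the theorem are gone here: \<open>mixture\<close> is all that is
  kept of the law \<open>P\<close>, and \<open>p_moment\<close> all that is kept of the Gaussian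
  tail.\<close>

locale latent_model =
  fixes p :: "real^'d \<Rightarrow> real" and A :: "real^'d^'n" and \<sigma> :: real and P :: "(real^'n) measure"
  assumes A: "transpose A ** A = mat 1" and \<sigma>: "\<sigma> > 0"
    and p_pos: "\<And>z. 0 < p z" and p_meas [measurable]: "p \<in> borel_measurable borel"
    and p_int: "(\<integral>\<^sup>+z. ennreal (p z) \<partial>lborel) = 1"
    and p_moment: "(\<integral>\<^sup>+z. ennreal (p z * (norm z)\<^sup>2) \<partial>lborel) < \<infinity>"
    and mixture: "\<And>t x. t > 0 \<Longrightarrow> ennreal (fwd_density P t x) =
      (\<integral>\<^sup>+z. ennreal (p z) * ennreal (gauss_density (fwd_alpha t *\<^sub>R (A *v z)) (htilde \<sigma> t) x) \<partial>lborel)"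
begin

lemma AtA [simp]: "transpose A *v (A *v z) = z"
  by (simp add: A matrix_vector_mul_assoc)

lemma inner_A: "(A *v z) \<bullet> x = z \<bullet> (transpose A *v x)"
  by (metis dot_lmul_matrix inner_commute transpose_matrix_vector)

lemma norm_A [simp]: "norm (A *v z) = norm z"
  by (simp add: norm_eq_sqrt_inner inner_A)

definition resid :: "real^'n \<Rightarrow> real^'n" where
  "resid x = x - A *v (transpose A *v x)"

definition reflect :: "real^'n \<Rightarrow> real^'n" where
  "reflect x = A *v (transpose A *v x) - resid x"

lemma At_resid [simp]: "transpose A *v resid x = 0"
  by (simp add: resid_def matrix_vector_mult_diff_distrib)

lemma A_resid [simp]: "(A *v z) \<bullet> resid x = 0"
  by (simp add: inner_A)

lemma decomp: "x = A *v (transpose A *v x) + resid x"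
  by (simp add: resid_def)

lemma At_reflect [simp]: "transpose A *v reflect x = transpose A *v x"
  by (simp add: reflect_def matrix_vector_mult_diff_distrib)

lemma resid_reflect [simp]: "resid (reflect x) = - resid x"
  unfolding resid_def[of "reflect x"] At_reflect by (simp add: reflect_def)

text \<open>The mixture components are centred in the column space of \<open>A\<close>. So each of
  them sees \<open>x\<close> only through \<open>transpose A *v x\<close> and the norm of
  \<open>resid x\<close>; this yields both the reflection symmetry and the product form of the
  forward density.\<close>

lemma pythagoras: "(norm (x - A *v w))\<^sup>2 = (norm (resid x))\<^sup>2 + (norm (transpose A *v x - w))\<^sup>2"
proof -
  have "x - A *v w = resid x + A *v (transpose A *v x - w)"
    by (simp add: resid_def matrix_vector_mult_diff_distrib)
  moreover have "orthogonal (resid x) (A *v (transpose A *v x - w))"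
    by (simp add: orthogonal_def inner_commute[of "resid x"])
  ultimately show ?thesis by (simp add: norm_add_Pythagorean)
qed

lemma orthogonal_reflect: "orthogonal_transformation reflect"
  unfolding orthogonal_transformation
proof (intro conjI allI)
  show "linear reflect"
    unfolding reflect_def resid_def by (intro linearI) (simp_all add: matrix_vector_right_distrib matrix_vector_mult_scaleR algebra_simps)
  fix x
  have "(norm (reflect x))\<^sup>2 = (norm x)\<^sup>2"
    using pythagoras[of "reflect x" 0] pythagoras[of x 0] by simp
  then show "norm (reflect x) = norm x" by simp
qed

lemma reflect_measurable [measurable]: "reflect \<in> borel_measurable borel"
  unfolding reflect_def resid_def by measurable

lemma resid_measurable [measurable]: "resid \<in> borel_measurable borel"
  unfolding resid_def by measurable

section \<open>The forward law at a fixed time: symmetry and moments\<close>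

context
  fixes t :: real assumes t: "t > 0"
begin

abbreviation "\<alpha> \<equiv> fwd_alpha t"
abbreviation "v \<equiv> htilde \<sigma> t"
abbreviation "N \<equiv> fwd_law P t"

lemma v: "v > 0" using t by (rule htilde_pos)

lemma fwd_density_measurable [measurable]: "fwd_density P t \<in> borel_measurable borel"
proof -
  have *: "fwd_density P t x = enn2real (\<integral>\<^sup>+z. ennreal (p z) * ennreal (gauss_density (\<alpha> *\<^sub>R (A *v z)) v x) \<partial>lborel)" for x
  proof -
    have "fwd_density P t x \<ge> 0"
      unfolding fwd_density_def using fwd_h_pos[OF t] by (simp add: gauss_density_nonneg)
    then show ?thesis unfolding mixture[OF t, symmetric] by simp
  qed
  show ?thesis unfolding * by measurable
qed

lemma sets_N [measurable_cong]: "sets N = sets borel"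
  by (simp add: fwd_law_def)

text \<open>With the centre shifted to 0, a moment under the forward law becomes an inner integral
  over isotropic noise followed by an outer one over the latent variable.\<close>

lemma nn_integral_N:
  fixes F :: "real^'n \<Rightarrow> ennreal"
  assumes [measurable]: "F \<in> borel_measurable borel"
  shows "(\<integral>\<^sup>+x. F x \<partial>N) = (\<integral>\<^sup>+z. ennreal (p z) *
     (\<integral>\<^sup>+x. ennreal (gauss_density 0 v x) * F (\<alpha> *\<^sub>R (A *v z) + x) \<partial>lborel) \<partial>lborel)"
proof -
  have "(\<integral>\<^sup>+x. F x \<partial>N) = (\<integral>\<^sup>+x. ennreal (fwd_density P t x) * F x \<partial>lborel)"
    unfolding fwd_law_def by (subst nn_integral_density) auto
  also have "\<dots> = (\<integral>\<^sup>+x. \<integral>\<^sup>+z. ennreal (p z) * ennreal (gauss_density (\<alpha> *\<^sub>R (A *v z)) v x) * F x \<partial>lborel \<partial>lborel)"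
    unfolding mixture[OF t] by (subst nn_integral_multc) auto
  also have "\<dots> = (\<integral>\<^sup>+z. \<integral>\<^sup>+x. ennreal (p z) * ennreal (gauss_density (\<alpha> *\<^sub>R (A *v z)) v x) * F x \<partial>lborel \<partial>lborel)"
    by (rule lborel_pair.Fubini') simp
  also have "\<dots> = (\<integral>\<^sup>+z. ennreal (p z) *
     (\<integral>\<^sup>+x. ennreal (gauss_density (\<alpha> *\<^sub>R (A *v z)) v x) * F x \<partial>lborel) \<partial>lborel)"
    by (simp add: mult.assoc nn_integral_cmult)
  also have "\<dots> = (\<integral>\<^sup>+z. ennreal (p z) *
     (\<integral>\<^sup>+x. ennreal (gauss_density 0 v x) * F (\<alpha> *\<^sub>R (A *v z) + x) \<partial>lborel) \<partial>lborel)"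
  proof -
    have "(\<integral>\<^sup>+x. ennreal (gauss_density m v x) * F x \<partial>lborel) = (\<integral>\<^sup>+x. ennreal (gauss_density 0 v x) * F (m + x) \<partial>lborel)" for m
      using nn_integral_lborel_translate[of "\<lambda>x. ennreal (gauss_density m v x) * F x" m]
      by (simp add: gauss_density_translate)
    then show ?thesis by simp
  qed
  finally show ?thesis .
qed

lemma prob_space_N: "prob_space N"
proof
  have "emeasure N (space N) = (\<integral>\<^sup>+x. 1 \<partial>N)" by simp
  also have "\<dots> = 1" by (subst nn_integral_N) (simp_all add: nn_integral_gauss_density v p_int)
  finally show "emeasure N (space N) = 1" .
qed

lemma fwd_density_reflect: "fwd_density P t (reflect x) = fwd_density P t x"
proof -
  have "gauss_density (\<alpha> *\<^sub>R (A *v z)) v (reflect x) = gauss_density (\<alpha> *\<^sub>R (A *v z)) v x" for z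
    using pythagoras[of "reflect x" "\<alpha> *\<^sub>R z"] pythagoras[of x "\<alpha> *\<^sub>R z"]
    by (simp add: gauss_density_def matrix_vector_mult_scaleR)
  then have "ennreal (fwd_density P t (reflect x)) = ennreal (fwd_density P t x)"
    unfolding mixture[OF t] by simp
  moreover have "fwd_density P t x \<ge> 0" for x
    unfolding fwd_density_def using fwd_h_pos[OF t] by (simp add: gauss_density_nonneg)
  ultimately show ?thesis by simp
qed

lemma distr_N_reflect: "distr N borel reflect = N"
proof (rule measure_eqI)
  show "sets (distr N borel reflect) = sets N" by (simp add: sets_N)
  fix S assume "S \<in> sets (distr N borel reflect)"
  then have [measurable]: "S \<in> sets borel" by simp
  have "emeasure (distr N borel reflect) S = (\<integral>\<^sup>+x. indicator S x \<partial>distr N borel reflect)"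
    by simp
  also have "\<dots> = (\<integral>\<^sup>+x. indicator S (reflect x) \<partial>N)"
    by (rule nn_integral_distr) simp_all
  also have "\<dots> = (\<integral>\<^sup>+x. ennreal (fwd_density P t (reflect x)) * indicator S (reflect x) \<partial>lborel)"
    unfolding fwd_law_def by (subst nn_integral_density) (auto simp: fwd_density_reflect)
  also have "\<dots> = (\<integral>\<^sup>+x. ennreal (fwd_density P t x) * indicator S x \<partial>lborel)"
    by (rule nn_integral_lborel_orthogonal[OF orthogonal_reflect]) simp
  also have "\<dots> = emeasure N S"
    unfolding fwd_law_def by (subst emeasure_density) auto
  finally show "emeasure (distr N borel reflect) S = emeasure N S" .
qed

text \<open>The law is its own image under \<open>reflect\<close>, so the integral equals its
  negative. For a non-integrable \<open>F\<close> the value is 0 by the convention for Bochner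
  integrals.\<close>

lemma integral_odd:
  fixes F :: "real^'n \<Rightarrow> real"
  assumes [measurable]: "F \<in> borel_measurable borel" and odd: "\<And>x. F (reflect x) = - F x"
  shows "(\<integral>x. F x \<partial>N) = 0"
proof -
  have "(\<integral>x. F x \<partial>N) = (\<integral>x. F x \<partial>distr N borel reflect)" by (simp add: distr_N_reflect)
  also have "\<dots> = - (\<integral>x. F x \<partial>N)" by (simp add: integral_distr odd)
  finally show ?thesis by simp
qed

text \<open>Every component mean lies in the column space of \<open>A\<close>, to which
  \<open>w\<close> is orthogonal, so only the isotropic noise contributes.\<close>

lemma nn_integral_inner_normal:
  assumes "transpose A *v w = 0"
  shows "(\<integral>\<^sup>+x. ennreal ((w \<bullet> x)\<^sup>2) \<partial>N) = ennreal (v * (norm w)\<^sup>2)"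
proof -
  have w: "w \<bullet> (\<alpha> *\<^sub>R (A *v z) + x) = w \<bullet> x" for z x
    using inner_A[of z w] assms by (simp add: inner_add_right inner_commute)
  have "(\<integral>\<^sup>+x. ennreal ((w \<bullet> x)\<^sup>2) \<partial>N) = (\<integral>\<^sup>+z. ennreal (p z) * ennreal (v * (norm w)\<^sup>2) \<partial>lborel)"
    by (subst nn_integral_N) (simp_all add: w ennreal_mult'[symmetric] gauss_density_nonneg v less_imp_le
      nn_integral_gauss_second_moment)
  also have "\<dots> = ennreal (v * (norm w)\<^sup>2)" by (simp add: nn_integral_multc p_int)
  finally show ?thesis .
qed

text \<open>The square of a sum of mean and noise is at most twice the sum of the squares; the means
  have finite second moment by \<open>p_moment\<close>, the noise by the Gaussian formula.\<close>

lemma integrable_norm2: "integrable N (\<lambda>x. (norm x)\<^sup>2)"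
proof (rule integrableI_bounded)
  have "(\<integral>\<^sup>+x. ennreal ((norm x)\<^sup>2) \<partial>N) \<le>
    (\<integral>\<^sup>+z. ennreal (p z) * (ennreal (2 * \<alpha>\<^sup>2 * (norm z)\<^sup>2) + ennreal (2 * (v * CARD('n)))) \<partial>lborel)"
  proof (subst nn_integral_N, simp, intro nn_integral_mono mult_left_mono)
    fix z :: "real^'d"
    have "(\<integral>\<^sup>+x. ennreal (gauss_density 0 v x) * ennreal ((norm (\<alpha> *\<^sub>R (A *v z) + x))\<^sup>2) \<partial>lborel)
     \<le> (\<integral>\<^sup>+x. ennreal (2 * \<alpha>\<^sup>2 * (norm z)\<^sup>2) * ennreal (gauss_density 0 v x) + ennreal 2 * ennreal (gauss_density 0 v x * (norm (x :: real^'n))\<^sup>2) \<partial>lborel)"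
    proof (intro nn_integral_mono)
      fix x :: "real^'n"
      have "norm (\<alpha> *\<^sub>R (A *v z) + x) \<le> \<alpha> * norm z + norm x"
        using norm_triangle_ineq[of "\<alpha> *\<^sub>R (A *v z)" x] fwd_alpha_pos[of t] by simp
      then have "(norm (\<alpha> *\<^sub>R (A *v z) + x))\<^sup>2 \<le> (\<alpha> * norm z + norm x)\<^sup>2"
        by (intro power_mono) auto
      also have "\<dots> \<le> 2 * \<alpha>\<^sup>2 * (norm z)\<^sup>2 + 2 * (norm x)\<^sup>2"
        using sum_squares_bound[of "\<alpha> * norm z" "norm x"] by (simp add: power2_sum power_mult_distrib)
      finally have "gauss_density 0 v x * (norm (\<alpha> *\<^sub>R (A *v z) + x))\<^sup>2
         \<le> gauss_density 0 v x * (2 * \<alpha>\<^sup>2 * (norm z)\<^sup>2 + 2 * (norm x)\<^sup>2)"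
        using v by (intro mult_left_mono) (auto simp: gauss_density_nonneg)
      then show "ennreal (gauss_density 0 v x) * ennreal ((norm (\<alpha> *\<^sub>R (A *v z) + x))\<^sup>2) \<le>
        ennreal (2 * \<alpha>\<^sup>2 * (norm z)\<^sup>2) * ennreal (gauss_density 0 v x) + ennreal 2 * ennreal (gauss_density 0 v x * (norm x)\<^sup>2)"
        using gauss_density_nonneg[of v 0 x] v
        by (subst (1 2 3) ennreal_mult[symmetric])
           (simp_all add: ennreal_plus[symmetric] algebra_simps ennreal_leI del: ennreal_plus)
    qed
    also have "\<dots> = ennreal (2 * \<alpha>\<^sup>2 * (norm z)\<^sup>2) + ennreal 2 * ennreal (v * CARD('n))"
      by (subst nn_integral_add) (simp_all add: nn_integral_cmult nn_integral_gauss_density v nn_integral_gauss_norm2)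
    finally show "(\<integral>\<^sup>+x. ennreal (gauss_density 0 v x) * ennreal ((norm (\<alpha> *\<^sub>R (A *v z) + x))\<^sup>2) \<partial>lborel)
       \<le> ennreal (2 * \<alpha>\<^sup>2 * (norm z)\<^sup>2) + ennreal (2 * (v * CARD('n)))"
      using v by (simp add: ennreal_mult')
  qed simp
  also have "\<dots> = (\<integral>\<^sup>+z. ennreal (2 * \<alpha>\<^sup>2) * ennreal (p z * (norm z)\<^sup>2) + ennreal (2 * (v * CARD('n))) * ennreal (p z) \<partial>lborel)"
    using p_pos by (intro nn_integral_cong) (simp add: ennreal_mult less_imp_le distrib_left ac_simps)
  also have "\<dots> = ennreal (2 * \<alpha>\<^sup>2) * (\<integral>\<^sup>+z. ennreal (p z * (norm z)\<^sup>2) \<partial>lborel) + ennreal (2 * (v * CARD('n)))"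
    by (subst nn_integral_add) (simp_all add: nn_integral_cmult p_int)
  also have "\<dots> < \<infinity>" using p_moment by (simp add: ennreal_mult_less_top)
  finally show "(\<integral>\<^sup>+x. ennreal (norm ((norm x)\<^sup>2)) \<partial>N) < \<infinity>" by simp
qed simp

end
end

text \<open>Inside the ball of radius \<open>b\<close> the factor \<open>(norm z)\<^sup>2\<close> is
  at most \<open>b\<^sup>2\<close>, which leaves the mass of \<open>p\<close>. Outside, the tail
  bound is \<open>L\<close> times the density of a centred Gaussian of variance
  \<open>1 / c\<close>, whose second moment is known.\<close>

lemma gaussian_tail_second_moment:
  fixes p :: "real^'d \<Rightarrow> real"
  assumes [measurable]: "p \<in> borel_measurable borel" and pos: "\<And>z. 0 < p z"
    and int: "(\<integral>\<^sup>+z. ennreal (p z) \<partial>lborel) = 1"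
    and K: "0 \<le> K" and c: "0 < c" and b: "0 \<le> b"
    and tail: "\<And>z. b \<le> norm z \<Longrightarrow> p z \<le> K * exp (- c * (norm z)\<^sup>2 / 2)"
  shows "(\<integral>\<^sup>+z. ennreal (p z * (norm z)\<^sup>2) \<partial>lborel) < \<infinity>"
proof -
  define L where "L = K * sqrt (2 * pi * (1 / c)) ^ CARD('d)"
  have L: "L \<ge> 0" using K c by (simp add: L_def)
  have eq: "K * exp (- c * (norm z)\<^sup>2 / 2) = L * gauss_density 0 (1 / c) z" for z :: "real^'d"
    using c by (simp add: L_def gauss_density_def)
  have "p z * (norm z)\<^sup>2 \<le> b\<^sup>2 * p z + L * (gauss_density 0 (1 / c) z * (norm z)\<^sup>2)" for z
  proof (cases "b \<le> norm z")
    case True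
    then have "p z * (norm z)\<^sup>2 \<le> L * gauss_density 0 (1 / c) z * (norm z)\<^sup>2"
      using tail[of z] eq[of z] by (intro mult_right_mono) auto
    then show ?thesis using pos[of z] by (simp add: mult.assoc add_increasing)
  next
    case False
    then have "p z * (norm z)\<^sup>2 \<le> p z * b\<^sup>2"
      using pos[of z] b by (intro mult_left_mono power_mono) auto
    then show ?thesis using L c by (simp add: gauss_density_nonneg mult.commute add_increasing2)
  qed
  then have "(\<integral>\<^sup>+z. ennreal (p z * (norm z)\<^sup>2) \<partial>lborel)
    \<le> (\<integral>\<^sup>+z. ennreal (b\<^sup>2) * ennreal (p z) + ennreal L * ennreal (gauss_density 0 (1 / c) z * (norm z)\<^sup>2) \<partial>lborel)"
    using pos L c by (intro nn_integral_mono)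
      (simp add: ennreal_mult'[symmetric] ennreal_plus[symmetric] gauss_density_nonneg less_imp_le ennreal_leI del: ennreal_plus)
  also have "\<dots> = ennreal (b\<^sup>2) + ennreal L * ennreal (1 / c * CARD('d))"
    using c by (subst nn_integral_add) (simp_all add: nn_integral_cmult int nn_integral_gauss_norm2)
  also have "\<dots> < \<infinity>" by (simp add: ennreal_mult_less_top)
  finally show ?thesis .
qed

section \<open>The score of the forward law\<close>

lemma grad_eqI:
  assumes "GDERIV f x :> D"
  shows "grad f x = D"
  unfolding grad_def
proof (rule the_equality)
  fix D' assume "GDERIV f x :> D'"
  with assms have "(\<lambda>h. h \<bullet> D') = (\<lambda>h. h \<bullet> D)"
    unfolding gderiv_def by (rule has_derivative_unique[rotated])
  then have "(D' - D) \<bullet> D' = (D' - D) \<bullet> D" by (rule fun_cong)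
  then have "(D' - D) \<bullet> (D' - D) = 0" by (simp add: inner_diff_right)
  then show "D' = D" by simp
qed fact

definition gauss_grad :: "real^'n \<Rightarrow> real \<Rightarrow> real^'n \<Rightarrow> real^'n" where
  "gauss_grad m v y = - (gauss_density m v y / v) *\<^sub>R (y - m)"

lemma gauss_grad_measurable [measurable]:
  assumes [measurable]: "f \<in> borel_measurable M" "g \<in> borel_measurable M"
  shows "(\<lambda>\<omega>. gauss_grad (f \<omega>) v (g \<omega>)) \<in> borel_measurable M"
  unfolding gauss_grad_def by measurable

lemma has_derivative_gauss_density:
  assumes "v > 0"
  shows "(gauss_density m v has_derivative (\<lambda>h. h \<bullet> gauss_grad m v y)) (at y)"
proof -
  have "((\<lambda>y. exp (- ((y - m) \<bullet> (y - m)) / (2 * v)) / sqrt (2 * pi * v) ^ CARD('n)) has_derivative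
     (\<lambda>h. h \<bullet> gauss_grad m v y)) (at y)" for y m :: "real^'n"
    using assms
    by (auto intro!: derivative_eq_intros simp: gauss_grad_def gauss_density_def power2_norm_eq_inner inner_commute inner_simps field_simps)
  then show ?thesis by (simp add: gauss_density_def[abs_def] power2_norm_eq_inner)
qed

text \<open>The function \<open>r * exp (- r\<^sup>2 / (2 * v))\<close> is bounded, by
  \<open>1 + u \<le> exp u\<close> at \<open>u = r\<^sup>2 / (2 * v)\<close>. Uniformity in the
  centre \<open>m\<close> is what provides a dominating function for the mixture.\<close>

lemma gauss_grad_bounded:
  assumes v: "v > 0"
  shows "\<exists>C. \<forall>(m::real^'n) y. norm (gauss_grad m v y) \<le> C"
proof (intro exI allI)
  fix m y :: "real^'n"
  define r where "r = norm (y - m)"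
  define s where "s = sqrt (2 * pi * v) ^ CARD('n)"
  have s: "s > 0" using v by (simp add: s_def)
  have "r \<le> (1 + r\<^sup>2) / 2" using sum_squares_bound[of r 1] by simp
  also have "\<dots> \<le> (1 + 2 * v) * (1 + r\<^sup>2 / (2 * v))" using v by (simp add: field_simps)
  also have "\<dots> \<le> (1 + 2 * v) * exp (r\<^sup>2 / (2 * v))"
    using v exp_ge_add_one_self[of "r\<^sup>2 / (2 * v)"] by (intro mult_left_mono) auto
  finally have "r * exp (- (r\<^sup>2 / (2 * v))) \<le> 1 + 2 * v"
    by (simp add: exp_minus field_simps)
  then have "r * exp (- (r\<^sup>2 / (2 * v))) / s / v \<le> (1 + 2 * v) / s / v"
    using s v by (intro divide_right_mono) auto
  then show "norm (gauss_grad m v y) \<le> (1 + 2 * v) / (sqrt (2 * pi * v) ^ CARD('n)) / v"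
    using v by (simp add: gauss_grad_def gauss_density_def r_def s_def ac_simps)
qed

lemma gauss_density_le:
  assumes "v > 0"
  shows "gauss_density (m::real^'n) v y \<le> 1 / sqrt (2 * pi * v) ^ CARD('n)"
  unfolding gauss_density_def using assms by (intro divide_right_mono) auto

lemma integrable_gauss_mixture:
  fixes c :: "'b \<Rightarrow> real^'n"
  assumes v: "v > 0" and p: "integrable M p" and [measurable]: "c \<in> borel_measurable M"
  shows "integrable M (\<lambda>z. gauss_density (c z) v y * p z)"
proof (rule Bochner_Integration.integrable_bound)
  have [measurable]: "p \<in> borel_measurable M" using p by simp
  show "integrable M (\<lambda>z. (1 / sqrt (2 * pi * v) ^ CARD('n)) * p z)" using p by simp
  show "AE z in M. norm (gauss_density (c z) v y * p z) \<le> norm ((1 / sqrt (2 * pi * v) ^ CARD('n)) * p z)"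
    using v gauss_density_le[OF v, of _ y] gauss_density_nonneg[of v _ y]
    by (intro AE_I2) (auto simp: abs_mult intro!: mult_right_mono simp del: times_divide_eq_left)
qed (use p in measurable)

text \<open>Differentiation under the integral sign. The normalised first-order remainders of the
  components tend to 0 pointwise and are bounded uniformly, so dominated convergence carries the
  limit through the integral against \<open>p\<close>.\<close>

lemma GDERIV_gauss_mixture:
  fixes c :: "'b \<Rightarrow> real^'n"
  assumes v: "v > 0" and p: "integrable M p" and [measurable]: "c \<in> borel_measurable M"
  shows "GDERIV (\<lambda>y. \<integral>z. gauss_density (c z) v y * p z \<partial>M) y :> (\<integral>z. p z *\<^sub>R gauss_grad (c z) v y \<partial>M)"
proof -
  have [measurable]: "p \<in> borel_measurable M" using p by simp
  obtain C where C: "\<And>m y :: real^'n. norm (gauss_grad m v y) \<le> C" using gauss_grad_bounded[OF v] by blast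
  let ?f = "\<lambda>y. \<integral>z. gauss_density (c z) v y * p z \<partial>M"
  let ?G = "\<integral>z. p z *\<^sub>R gauss_grad (c z) v y \<partial>M"
  have intG: "integrable M (\<lambda>z. p z *\<^sub>R gauss_grad (c z) v y)"
  proof (rule Bochner_Integration.integrable_bound)
    show "integrable M (\<lambda>z. C * p z)" using p by simp
    show "AE z in M. norm (p z *\<^sub>R gauss_grad (c z) v y) \<le> norm (C * p z)"
      using order_trans[OF C abs_ge_self] by (intro AE_I2) (simp add: abs_mult mult.commute[of "\<bar>C\<bar>"] mult_left_mono)
  qed measurable
  \<comment> \<open>The mean value inequality turns the bound \<open>C\<close> on the gradients into
    a Lipschitz constant common to all centres.\<close>
  have lip: "\<bar>gauss_density m v (y + h) - gauss_density m v y\<bar> \<le> C * norm h" for m y h :: "real^'n"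
  proof -
    have "norm (gauss_density m v (y + h) - gauss_density m v y) \<le> C * norm (y + h - y)"
    proof (rule differentiable_bound[where S=UNIV])
      fix x :: "real^'n"
      show "(gauss_density m v has_derivative (\<lambda>h. h \<bullet> gauss_grad m v x)) (at x)"
        by (rule has_derivative_gauss_density[OF v])
      have "\<bar>h \<bullet> gauss_grad m v x\<bar> \<le> C * norm h" for h
        using Cauchy_Schwarz_ineq2[of h "gauss_grad m v x"] mult_left_mono[OF C[of m x], of "norm h"]
        by (simp add: mult.commute)
      then show "onorm (\<lambda>h. h \<bullet> gauss_grad m v x) \<le> C"
        by (intro onorm_le) simp
    qed auto
    then show ?thesis by simp
  qed
  define e where "e h z = (gauss_density (c z) v (y + h) - gauss_density (c z) v y - h \<bullet> gauss_grad (c z) v y) / norm h" for h z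
  \<comment> \<open>One \<open>C\<close> comes from the increment, one from the linear term. At
    \<open>h = 0\<close> the quotient is 0, as division by zero gives 0.\<close>
  have e_bound: "\<bar>e h z\<bar> \<le> 2 * C" for h z
  proof (cases "h = 0")
    case True
    have "0 \<le> C" using C[of 0 0] norm_ge_zero order_trans by blast
    then show ?thesis using True by (simp add: e_def)
  next
    case False
    have "\<bar>h \<bullet> gauss_grad (c z) v y\<bar> \<le> C * norm h"
      using Cauchy_Schwarz_ineq2[of h "gauss_grad (c z) v y"] mult_left_mono[OF C[of "c z" y], of "norm h"]
      by (simp add: mult.commute)
    then have "\<bar>gauss_density (c z) v (y + h) - gauss_density (c z) v y - h \<bullet> gauss_grad (c z) v y\<bar> \<le> 2 * C * norm h"
      using lip[of "c z" y h] by linarith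
    then show ?thesis using False by (simp add: e_def pos_divide_le_eq)
  qed
  have [measurable]: "e h \<in> borel_measurable M" for h
    unfolding e_def by measurable
  have e_int: "(\<integral>z. e h z * p z \<partial>M) = (?f (y + h) - ?f y - h \<bullet> ?G) / norm h" for h
  proof -
    have "(\<integral>z. e h z * p z \<partial>M) = (\<integral>z. (gauss_density (c z) v (y + h) * p z - gauss_density (c z) v y * p z
       - h \<bullet> (p z *\<^sub>R gauss_grad (c z) v y)) / norm h \<partial>M)"
      by (intro Bochner_Integration.integral_cong) (auto simp: e_def algebra_simps)
    also have "\<dots> = (?f (y + h) - ?f y - h \<bullet> ?G) / norm h"
    proof -
      note i = integrable_gauss_mixture[OF v p \<open>c \<in> _\<close>]
      have "integrable M (\<lambda>z. h \<bullet> (p z *\<^sub>R gauss_grad (c z) v y))"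
        by (rule integrable_inner_right) (rule intG)
      moreover have "(\<integral>z. h \<bullet> (p z *\<^sub>R gauss_grad (c z) v y) \<partial>M) = h \<bullet> ?G"
        by (rule integral_inner_right) (rule intG)
      ultimately show ?thesis using i by (simp del: inner_scaleR_right)
    qed
    finally show ?thesis .
  qed
  have lim: "((\<lambda>h. \<integral>z. e h z * p z \<partial>M) \<longlongrightarrow> 0) (at 0)"
    \<comment> \<open>Dominated convergence is applied along an arbitrary sequence of nonzero
      increments.\<close>
    unfolding tendsto_at_iff_sequentially o_def
  proof (intro allI impI)
    fix X :: "nat \<Rightarrow> real^'n" assume X: "\<forall>i. X i \<in> UNIV - {0}" "X \<longlonglongrightarrow> 0"
    have "(\<lambda>i. \<integral>z. e (X i) z * p z \<partial>M) \<longlonglongrightarrow> (\<integral>z. 0 \<partial>M)"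
    proof (rule integral_dominated_convergence[where w = "\<lambda>z. 2 * C * \<bar>p z\<bar>"])
      show "integrable M (\<lambda>z. 2 * C * \<bar>p z\<bar>)" using p by simp
      show "AE z in M. norm (e (X i) z * p z) \<le> 2 * C * \<bar>p z\<bar>" for i
        using e_bound by (intro AE_I2) (simp add: abs_mult mult_right_mono)
      show "AE z in M. (\<lambda>i. e (X i) z * p z) \<longlonglongrightarrow> 0"
      proof (intro AE_I2)
        fix z
        have "((\<lambda>h. norm (gauss_density (c z) v (y + h) - gauss_density (c z) v y - h \<bullet> gauss_grad (c z) v y) / norm h) \<longlongrightarrow> 0) (at 0)"
          using has_derivative_gauss_density[OF v, of "c z" y] unfolding has_derivative_at by blast
        then have "((\<lambda>h. \<bar>e h z\<bar>) \<longlongrightarrow> 0) (at 0)" by (simp add: e_def)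
        then have "((\<lambda>h. e h z) \<longlongrightarrow> 0) (at 0)" by (simp add: tendsto_rabs_zero_iff)
        then have "(\<lambda>i. e (X i) z) \<longlonglongrightarrow> 0"
          using X unfolding tendsto_at_iff_sequentially o_def by blast
        then show "(\<lambda>i. e (X i) z * p z) \<longlonglongrightarrow> 0" by (rule tendsto_mult_left_zero)
      qed
    qed simp_all
    then show "(\<lambda>i. \<integral>z. e (X i) z * p z \<partial>M) \<longlonglongrightarrow> 0" by simp
  qed
  show ?thesis
    unfolding gderiv_def has_derivative_at
  proof
    show "bounded_linear (\<lambda>h. h \<bullet> ?G)" by (rule bounded_linear_inner_left)
    have "((\<lambda>h. \<bar>\<integral>z. e h z * p z \<partial>M\<bar>) \<longlongrightarrow> 0) (at 0)" using lim by (rule tendsto_rabs_zero)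
    then show "((\<lambda>h. norm (?f (y + h) - ?f y - h \<bullet> ?G) / norm h) \<longlongrightarrow> 0) (at 0)"
      unfolding e_int by simp
  qed
qed

section \<open>The score in latent coordinates\<close>

context latent_model
begin

context
  fixes t :: real assumes t: "t > 0"
begin

lemma integrable_p: "integrable lborel p"
  by (rule integrableI_bounded) (simp_all add: p_int less_imp_le[OF p_pos])

lemma integrable_latent: "integrable lborel (\<lambda>z. gauss_density (\<alpha> t *\<^sub>R z) (v t) y * p z)"
  by (rule integrable_gauss_mixture[OF v[OF t] integrable_p]) simp

lemma latent_density_eq:
  "ennreal (latent_density \<sigma> p t y) = (\<integral>\<^sup>+z. ennreal (p z) * ennreal (gauss_density (\<alpha> t *\<^sub>R z) (v t) y) \<partial>lborel)"
  unfolding latent_density_def using integrable_latent v[OF t] p_pos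
  by (subst nn_integral_eq_integral[symmetric])
     (auto simp: gauss_density_nonneg less_imp_le ennreal_mult mult.commute intro!: nn_integral_cong)

lemma latent_density_pos: "0 < latent_density \<sigma> p t y"
proof -
  have pos: "0 < gauss_density (\<alpha> t *\<^sub>R z) (v t) y * p z" for z
    using v[OF t] p_pos by (simp add: gauss_density_pos)
  have "latent_density \<sigma> p t y \<noteq> 0"
  proof
    assume "latent_density \<sigma> p t y = 0"
    then have "AE z in lborel. gauss_density (\<alpha> t *\<^sub>R z) (v t) y * p z = 0"
      unfolding latent_density_def using integrable_latent pos
      by (subst (asm) integral_nonneg_eq_0_iff_AE) (auto simp: less_imp_le)
    then have "AE z::real^'d in lborel. False" by (rule eventually_mono) (use pos in \<open>simp add: less_le\<close>)
    then have "emeasure lborel (UNIV :: (real^'d) set) = 0" by (simp add: AE_iff_null null_sets_def)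
    then show False by simp
  qed
  moreover have "latent_density \<sigma> p t y \<ge> 0"
    unfolding latent_density_def using pos by (intro integral_nonneg_AE AE_I2) (simp add: less_imp_le)
  ultimately show ?thesis by simp
qed

text \<open>\<open>latent_score\<close> is defined by \<open>THE\<close> and becomes a true gradient
  only once some gradient exists. Differentiating the mixture supplies one, and positivity of the
  density carries it through \<open>ln\<close>.\<close>

lemma GDERIV_ln_latent: "GDERIV (\<lambda>u. ln (latent_density \<sigma> p t u)) y :> latent_score \<sigma> p t y"
proof -
  have "GDERIV (latent_density \<sigma> p t) y :> (\<integral>z. p z *\<^sub>R gauss_grad (\<alpha> t *\<^sub>R z) (v t) y \<partial>lborel)"
    unfolding latent_density_def[abs_def] by (rule GDERIV_gauss_mixture[OF v[OF t] integrable_p]) simp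
  from GDERIV_DERIV_compose[OF this DERIV_ln_divide[OF latent_density_pos]]
  obtain D where "GDERIV (\<lambda>u. ln (latent_density \<sigma> p t u)) y :> D" by blast
  with grad_eqI[OF this] show ?thesis unfolding latent_score_def by simp
qed

text \<open>By \<open>pythagoras\<close> the part of the exponent that comes from
  \<open>resid x\<close> is the same for every \<open>z\<close>, so it leaves the mixture
  integral.\<close>

lemma fwd_density_factor:
  "\<exists>K>0. \<forall>x. fwd_density P t x = K * exp (- (norm (resid x))\<^sup>2 / (2 * v t)) * latent_density \<sigma> p t (transpose A *v x)"
proof (intro exI conjI allI)
  \<comment> \<open>The quotient of the normalising constants of Gaussians of variance
    \<open>v t\<close> in the latent and in the ambient dimension.\<close>
  let ?K = "sqrt (2 * pi * v t) ^ CARD('d) / sqrt (2 * pi * v t) ^ CARD('n)"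
  show "0 < ?K" using v[OF t] by simp
  fix x
  let ?E = "?K * exp (- (norm (resid x))\<^sup>2 / (2 * v t))"
  have E: "?E \<ge> 0" using v[OF t] by simp
  have *: "gauss_density (\<alpha> t *\<^sub>R (A *v z)) (v t) x = ?E * gauss_density (\<alpha> t *\<^sub>R z) (v t) (transpose A *v x)" for z
    using v[OF t] unfolding gauss_density_def matrix_vector_mult_scaleR[symmetric] pythagoras[of x]
    by (simp add: add_divide_distrib exp_add[symmetric] field_simps)
  have "ennreal (fwd_density P t x) = (\<integral>\<^sup>+z. ennreal ?E * (ennreal (p z) * ennreal (gauss_density (\<alpha> t *\<^sub>R z) (v t) (transpose A *v x))) \<partial>lborel)"
    unfolding mixture[OF t] * ennreal_mult'[OF E] by (simp add: ac_simps)
  also have "\<dots> = ennreal (?E * latent_density \<sigma> p t (transpose A *v x))"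
    unfolding ennreal_mult'[OF E] latent_density_eq by (rule nn_integral_cmult) simp
  finally have "ennreal (fwd_density P t x) = ennreal (?E * latent_density \<sigma> p t (transpose A *v x))" .
  moreover have "fwd_density P t x \<ge> 0"
    unfolding fwd_density_def using fwd_h_pos[OF t] by (simp add: gauss_density_nonneg)
  ultimately show "fwd_density P t x = ?E * latent_density \<sigma> p t (transpose A *v x)"
    using mult_nonneg_nonneg[OF E less_imp_le[OF latent_density_pos[of "transpose A *v x"]]] by (subst (asm) ennreal_inj)
qed

lemma grad_ln_fwd_density:
  "grad (\<lambda>u. ln (fwd_density P t u)) x = A *v latent_score \<sigma> p t (transpose A *v x) - (1 / v t) *\<^sub>R resid x"
proof (rule grad_eqI)
  obtain K where K: "K > 0" and eq: "\<And>x. fwd_density P t x = K * exp (- (norm (resid x))\<^sup>2 / (2 * v t)) * latent_density \<sigma> p t (transpose A *v x)"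
    using fwd_density_factor by blast
  have ln: "ln (fwd_density P t u) = ln K - (resid u \<bullet> resid u) / (2 * v t) + ln (latent_density \<sigma> p t (transpose A *v u))" for u
    unfolding eq using K latent_density_pos[of "transpose A *v u"] by (simp add: ln_mult power2_norm_eq_inner)
  let ?s = "latent_score \<sigma> p t (transpose A *v x)"
  have bl: "bounded_linear resid"
    unfolding resid_def by (intro bounded_linear_sub bounded_linear_ident matrix_vector_mul_bounded_linear
       bounded_linear_compose[OF matrix_vector_mul_bounded_linear])
  have 1: "(resid has_derivative resid) (at x)" using bl by (rule bounded_linear_imp_has_derivative)
  have 2: "((\<lambda>u. transpose A *v u) has_derivative (\<lambda>u. transpose A *v u)) (at x)"
    by (intro bounded_linear_imp_has_derivative matrix_vector_mul_bounded_linear)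
  have 3: "((\<lambda>u. ln (latent_density \<sigma> p t (transpose A *v u))) has_derivative (\<lambda>h. (transpose A *v h) \<bullet> ?s)) (at x)"
    using diff_chain_at[OF 2 GDERIV_ln_latent[unfolded gderiv_def]] by (simp add: o_def)
  have "((\<lambda>u. ln (fwd_density P t u)) has_derivative
     (\<lambda>h. 0 - (resid x \<bullet> resid h + resid h \<bullet> resid x) / (2 * v t) + (transpose A *v h) \<bullet> ?s)) (at x)"
    unfolding ln
    by (intro has_derivative_add has_derivative_diff has_derivative_const 3
        bounded_linear.has_derivative[OF bounded_linear_divide] has_derivative_inner 1)
  moreover have "0 - (resid x \<bullet> resid h + resid h \<bullet> resid x) / (2 * v t) + (transpose A *v h) \<bullet> ?s
     = h \<bullet> (A *v ?s - (1 / v t) *\<^sub>R resid x)" for h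
  proof -
    \<comment> \<open>The component of \<open>h\<close> in the column space of \<open>A\<close> is
      orthogonal to \<open>resid x\<close>, so the derivative of the quadratic term needs no second
      projection.\<close>
    have "resid h \<bullet> resid x = h \<bullet> resid x" unfolding resid_def[of h] by (simp add: inner_diff_left)
    moreover have "(transpose A *v h) \<bullet> ?s = h \<bullet> (A *v ?s)" by (metis inner_A inner_commute)
    ultimately show ?thesis by (simp add: inner_diff_right inner_commute[of "resid x"])
  qed
  ultimately show "GDERIV (\<lambda>u. ln (fwd_density P t u)) x :> (A *v ?s - (1 / v t) *\<^sub>R resid x)"
    unfolding gderiv_def by simp
qed

end
end

section \<open>Pseudoinverse, principal angles and singular values\<close>

lemma inner_matrix_vector: "((M :: real^'n^'m) *v x) \<bullet> y = x \<bullet> (transpose M *v y)"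
  by (metis dot_lmul_matrix inner_commute transpose_matrix_vector)

text \<open>\<open>A ** Q\<close> and \<open>A ** P\<close> are symmetric and fix \<open>A\<close>
  from the left. Their product in one order is \<open>A ** P\<close>, in the other
  \<open>A ** Q\<close>, and transposition exchanges the orders. The same argument on the other side
  gives \<open>P ** A = Q ** A\<close>.\<close>

lemma is_pinv_unique:
  assumes P: "is_pinv A P" and Q: "is_pinv A Q"
  shows "P = Q"
proof -
  have p: "A ** P ** A = A" "P ** A ** P = P" "transpose (A ** P) = A ** P" "transpose (P ** A) = P ** A"
    using P by (auto simp: is_pinv_def)
  have q: "A ** Q ** A = A" "Q ** A ** Q = Q" "transpose (A ** Q) = A ** Q" "transpose (Q ** A) = Q ** A"
    using Q by (auto simp: is_pinv_def)
  have "A ** P = transpose ((A ** Q ** A) ** P)" using p q by simp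
  also have "\<dots> = transpose ((A ** Q) ** (A ** P))" by (simp add: matrix_mul_assoc)
  also have "\<dots> = (A ** P) ** (A ** Q)" by (simp only: matrix_transpose_mul[of "A ** Q"] p q)
  also have "\<dots> = A ** Q" using p by (simp add: matrix_mul_assoc)
  finally have AP: "A ** P = A ** Q" .
  have "P ** A = transpose (P ** (A ** Q ** A))" using p q by simp
  also have "\<dots> = transpose ((P ** A) ** (Q ** A))" by (simp add: matrix_mul_assoc)
  also have "\<dots> = (Q ** A) ** (P ** A)" by (simp only: matrix_transpose_mul[of "P ** A"] p q)
  also have "\<dots> = Q ** (A ** P ** A)" by (simp add: matrix_mul_assoc)
  also have "\<dots> = Q ** A" using p by simp
  finally have PA: "P ** A = Q ** A" .
  have "P = Q ** A ** P" using p PA by simp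
  also have "\<dots> = Q ** A ** Q" using AP by (simp add: matrix_mul_assoc[symmetric])
  finally show ?thesis using q by simp
qed

lemma pinv_eqI: "is_pinv A P \<Longrightarrow> pinv A = P"
  unfolding pinv_def by (rule the_equality) (auto intro: is_pinv_unique)

section \<open>Symmetric matrices and their largest eigenvalue\<close>

lemma transpose_eq_self_iff:
  "transpose M = M \<longleftrightarrow> (\<forall>x y. ((M :: real^'n^'n) *v x) \<bullet> y = x \<bullet> (M *v y))"
proof
  assume *: "\<forall>x y. (M *v x) \<bullet> y = x \<bullet> (M *v y)"
  have "transpose M *v y = M *v y" for y
  proof -
    have "x \<bullet> (transpose M *v y) = x \<bullet> (M *v y)" for x using * by (simp add: inner_matrix_vector)
    then show ?thesis using vector_eq_ldot by blast
  qed
  then show "transpose M = M" by (simp add: matrix_eq)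
qed (simp add: inner_matrix_vector)

text \<open>Eigenvectors of distinct eigenvalues are orthogonal, so one eigenvector per eigenvalue
  forms an independent set. Finiteness is what gives the \<open>Max\<close> in
  \<open>lambda_max\<close> its meaning.\<close>

lemma finite_eigenvalues_symmetric:
  fixes M :: "real^'n^'n"
  assumes sym: "transpose M = M"
  shows "finite (eigenvalues M)"
proof -
  obtain f where f: "\<And>l. l \<in> eigenvalues M \<Longrightarrow> f l \<noteq> 0 \<and> M *v f l = l *\<^sub>R f l"
    using bchoice[of "eigenvalues M" "\<lambda>l v. v \<noteq> 0 \<and> M *v v = l *\<^sub>R v"] by (auto simp: eigenvalues_def)
  have orth: "f l \<bullet> f l' = 0" if "l \<in> eigenvalues M" "l' \<in> eigenvalues M" "l \<noteq> l'" for l l'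
  proof -
    have "(M *v f l) \<bullet> f l' = f l \<bullet> (M *v f l')" using sym by (simp add: inner_matrix_vector)
    then show ?thesis using f that by simp
  qed
  have inj: "inj_on f (eigenvalues M)"
    using orth f by (metis inj_onI inner_eq_zero_iff)
  have "independent (f ` eigenvalues M)"
  proof (rule pairwise_orthogonal_independent)
    show "pairwise orthogonal (f ` eigenvalues M)"
      using orth by (auto simp: pairwise_def orthogonal_def)
    show "0 \<notin> f ` eigenvalues M" using f by force
  qed
  then have "finite (f ` eigenvalues M)" by (rule independent_imp_finite)
  then show ?thesis using inj by (simp add: finite_image_iff)
qed

text \<open>A maximiser \<open>u\<close> of the quadratic form on the unit sphere exists by
  compactness. A variational argument shows that it is an eigenvector, so the maximum
  \<open>m\<close> is an eigenvalue.\<close>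

lemma quadratic_form_le_lambda_max:
  fixes M :: "real^'n^'n"
  assumes sym: "transpose M = M"
  shows "v \<bullet> (M *v v) \<le> lambda_max M * (norm v)\<^sup>2"
proof -
  let ?f = "\<lambda>v. v \<bullet> (M *v v)"
  have "\<exists>u\<in>sphere 0 1. \<forall>v\<in>sphere 0 1. ?f v \<le> ?f u"
  proof (rule continuous_attains_sup)
    show "sphere (0::real^'n) 1 \<noteq> {}" by simp
    show "continuous_on (sphere 0 1) ?f"
      by (intro continuous_intros linear_continuous_on matrix_vector_mul_bounded_linear)
  qed simp
  then obtain u where u: "norm u = 1" and max: "\<And>v. norm v = 1 \<Longrightarrow> ?f v \<le> ?f u" by auto
  define m where "m = ?f u"
  have le: "?f v \<le> m * (norm v)\<^sup>2" for v
  proof (cases "v = 0")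
    case False
    have "?f (v /\<^sub>R norm v) \<le> m" unfolding m_def using False by (intro max) simp
    moreover have "?f (v /\<^sub>R norm v) = ?f v / (norm v)\<^sup>2"
      by (simp add: matrix_vector_mult_scaleR power2_eq_square divide_inverse)
    ultimately have "?f v / (norm v)\<^sup>2 \<le> m" by simp
    then show ?thesis using False by (simp add: pos_divide_le_eq)
  qed simp
  \<comment> \<open>The direction in which \<open>u\<close> fails to be an eigenvector. Moving
    \<open>u\<close> along it raises the form to first order but the squared norm only to second
    order, so it must vanish.\<close>
  define x where "x = M *v u - m *\<^sub>R u"
  have xu: "x \<bullet> u = 0" using u unfolding norm_eq_1 by (simp add: x_def inner_diff_left m_def inner_commute[of "M *v u"])
  have xMu: "x \<bullet> (M *v u) = x \<bullet> x" using xu by (simp add: x_def inner_diff_right)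
  have uMx: "u \<bullet> (M *v x) = x \<bullet> x"
    using xMu sym by (metis inner_commute inner_matrix_vector)
  have "2 * (x \<bullet> x) \<le> e * (m * (x \<bullet> x) - ?f x)" if "e > 0" for e
  proof -
    have "?f (u + e *\<^sub>R x) \<le> m * (norm (u + e *\<^sub>R x))\<^sup>2" by (rule le)
    also have "(norm (u + e *\<^sub>R x))\<^sup>2 = 1 + e\<^sup>2 * (x \<bullet> x)"
      using xu u unfolding power2_norm_eq_inner
      by (simp add: inner_add_left inner_add_right inner_commute power2_eq_square norm_eq_1)
    also have "?f (u + e *\<^sub>R x) = m + 2 * e * (x \<bullet> x) + e\<^sup>2 * ?f x"
      by (simp add: matrix_vector_right_distrib matrix_vector_mult_scaleR inner_add_left inner_add_right
         xMu uMx m_def power2_eq_square distrib_left)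
    finally have "e * (2 * (x \<bullet> x)) \<le> e * (e * (m * (x \<bullet> x) - ?f x))"
      by (simp add: algebra_simps power2_eq_square)
    then show ?thesis using that by simp
  qed
  note * = this
  have "x \<bullet> x \<le> 0"
  proof (rule ccontr)
    assume "\<not> x \<bullet> x \<le> 0"
    then have pos: "x \<bullet> x > 0" by (rule not_le_imp_less)
    \<comment> \<open>The step \<open>e = (x \<bullet> x) / k\<close> turns the inequality into
      \<open>2 * (x \<bullet> x) \<le> x \<bullet> x\<close>; the summand 1 keeps \<open>k\<close>
      positive.\<close>
    define k where "k = \<bar>m * (x \<bullet> x) - ?f x\<bar> + 1"
    have k: "k > 0" "m * (x \<bullet> x) - ?f x \<le> k" by (auto simp: k_def)
    have "2 * (x \<bullet> x) \<le> (x \<bullet> x) / k * (m * (x \<bullet> x) - ?f x)" using pos k by (intro *) simp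
    also have "\<dots> \<le> (x \<bullet> x) / k * k" using pos k by (intro mult_left_mono) auto
    finally show False using pos k by simp
  qed
  then have "x = 0" by (metis inner_gt_zero_iff not_le)
  then have "m \<in> eigenvalues M"
    unfolding eigenvalues_def using u by (auto simp: x_def intro!: exI[of _ u])
  then have "m \<le> lambda_max M"
    unfolding lambda_max_def by (rule Max_ge[OF finite_eigenvalues_symmetric[OF sym]])
  then show ?thesis using le[of v] by (meson mult_right_mono order_trans zero_le_power2)
qed

section \<open>Orthonormal families and the Frobenius norm\<close>

lemma orthonormal_family_expand:
  fixes b :: "nat \<Rightarrow> real^'n"
  assumes on: "\<And>i j. i \<in> {1..CARD('n)} \<Longrightarrow> j \<in> {1..CARD('n)} \<Longrightarrow> b i \<bullet> b j = (if i = j then 1 else 0)"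
  shows "(\<Sum>j=1..CARD('n). (x \<bullet> b j) *\<^sub>R b j) = x"
proof -
  let ?S = "b ` {1..CARD('n)}"
  have inj: "inj_on b {1..CARD('n)}" using on by (metis inj_onI zero_neq_one)
  have norm: "norm i = 1" if "i \<in> ?S" for i using that on by (auto simp: norm_eq_1)
  have orth: "pairwise orthogonal ?S" using on by (auto simp: pairwise_def orthogonal_def)
  have "independent ?S" using orth norm by (intro pairwise_orthogonal_independent) (metis norm_zero zero_neq_one)+
  then have "dim ?S = CARD('n)" using inj by (simp add: dim_eq_card_independent card_image)
  then have "span ?S = UNIV" using dim_eq_full[of ?S] by simp
  then have "(\<Sum>i\<in>?S. (x \<bullet> i) *\<^sub>R i) = x"
    using orth norm by (intro orthonormal_basis_expand) auto
  then show ?thesis using inj by (simp add: sum.reindex)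
qed

lemma orthonormal_family_parseval:
  fixes b :: "nat \<Rightarrow> real^'n"
  assumes on: "\<And>i j. i \<in> {1..CARD('n)} \<Longrightarrow> j \<in> {1..CARD('n)} \<Longrightarrow> b i \<bullet> b j = (if i = j then 1 else 0)"
  shows "(norm x)\<^sup>2 = (\<Sum>j=1..CARD('n). (x \<bullet> b j)\<^sup>2)"
proof -
  have "(norm x)\<^sup>2 = x \<bullet> (\<Sum>j=1..CARD('n). (x \<bullet> b j) *\<^sub>R b j)"
    using orthonormal_family_expand[OF on] by (simp add: power2_norm_eq_inner)
  also have "\<dots> = (\<Sum>j=1..CARD('n). (x \<bullet> b j)\<^sup>2)" by (simp add: inner_sum_right power2_eq_square)
  finally show ?thesis .
qed

lemma norm_orthonormal_sum:
  fixes b :: "nat \<Rightarrow> 'a::real_inner"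
  assumes on: "\<And>i j. i \<in> {1..r} \<Longrightarrow> j \<in> {1..r} \<Longrightarrow> b i \<bullet> b j = (if i = j then 1 else 0)"
  shows "(norm (\<Sum>j=1..r. c j *\<^sub>R b j))\<^sup>2 = (\<Sum>j=1..r. (c j)\<^sup>2)"
proof -
  have "(norm (\<Sum>j=1..r. c j *\<^sub>R b j))\<^sup>2 = (\<Sum>i=1..r. \<Sum>j=1..r. c i * c j * (b j \<bullet> b i))"
    unfolding power2_norm_eq_inner by (simp add: inner_sum_left inner_sum_right sum_distrib_left mult.assoc)
  also have "\<dots> = (\<Sum>i=1..r. \<Sum>j=1..r. if i = j then (c i)\<^sup>2 else 0)"
    by (intro sum.cong refl) (simp add: on power2_eq_square)
  also have "\<dots> = (\<Sum>j=1..r. (c j)\<^sup>2)" by simp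
  finally show ?thesis .
qed

text \<open>The squared Frobenius norm. The traces that depend on the angles are expressed by it,
  because it can be computed in any orthonormal basis of either side; in the singular basis of B it
  is the sum of the squared cosines.\<close>

definition frob2 :: "real^'n^'m \<Rightarrow> real" where
  "frob2 M = (\<Sum>i\<in>UNIV. \<Sum>j\<in>UNIV. (M $ i $ j)\<^sup>2)"

lemma norm2_eq_sum: "(norm (x :: real^'n))\<^sup>2 = (\<Sum>i\<in>UNIV. (x $ i)\<^sup>2)"
  unfolding power2_norm_eq_inner inner_vec_def by (simp add: power2_eq_square)

lemma frob2_columns: "frob2 (M :: real^'n^'m) = (\<Sum>j\<in>UNIV. (norm (M *v axis j 1))\<^sup>2)"
  unfolding frob2_def norm2_eq_sum
  by (subst sum.swap) (simp add: matrix_vector_mult_basis column_def)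

lemma frob2_transpose: "frob2 (transpose M) = frob2 M"
  unfolding frob2_def by (subst sum.swap) (simp add: transpose_def)

lemma frob2_rows: "frob2 M = (\<Sum>i\<in>UNIV. (norm (transpose M *v axis i 1))\<^sup>2)"
  by (simp flip: frob2_columns add: frob2_transpose)

text \<open>Parseval's identity applied to each row of \<open>M\<close>.\<close>

lemma frob2_orthonormal:
  fixes b :: "nat \<Rightarrow> real^'n" and M :: "real^'n^'m"
  assumes on: "\<And>i j. i \<in> {1..CARD('n)} \<Longrightarrow> j \<in> {1..CARD('n)} \<Longrightarrow> b i \<bullet> b j = (if i = j then 1 else 0)"
  shows "frob2 M = (\<Sum>j=1..CARD('n). (norm (M *v b j))\<^sup>2)"
proof -
  have "frob2 M = (\<Sum>i\<in>UNIV. \<Sum>j=1..CARD('n). ((transpose M *v axis i 1) \<bullet> b j)\<^sup>2)"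
    unfolding frob2_rows by (intro sum.cong refl orthonormal_family_parseval[OF on])
  also have "\<dots> = (\<Sum>j=1..CARD('n). \<Sum>i\<in>UNIV. ((M *v b j) $ i)\<^sup>2)"
    by (subst sum.swap) (simp add: inner_matrix_vector inner_axis' transpose_transpose)
  finally show ?thesis by (simp add: norm2_eq_sum)
qed

section \<open>Principal vectors\<close>

lemma extremal_inner_orthogonal:
  fixes u x w :: "'a::real_inner"
  assumes "norm u = 1" "norm x = 1" "u \<bullet> x = 0"
    and max: "\<And>a b. a\<^sup>2 + b\<^sup>2 = 1 \<Longrightarrow> (a *\<^sub>R u + b *\<^sub>R x) \<bullet> w \<le> u \<bullet> w"
  shows "x \<bullet> w = 0"
proof (rule ccontr)
  define s c where "s = u \<bullet> w" and "c = x \<bullet> w"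
  define R where "R = sqrt (s\<^sup>2 + c\<^sup>2)"
  assume "x \<bullet> w \<noteq> 0"
  then have c: "c\<^sup>2 > 0" by (simp add: c_def)
  then have R: "R > 0" "R\<^sup>2 = s\<^sup>2 + c\<^sup>2" unfolding R_def by (simp_all add: add_nonneg_pos)
  \<comment> \<open>The unit vector with coordinates \<open>s / R\<close> and \<open>c / R\<close>
    points along the projection of \<open>w\<close> to the plane of \<open>u\<close> and
    \<open>x\<close>. Its inner product with \<open>w\<close> is \<open>R\<close>, which exceeds
    \<open>s\<close> unless \<open>c = 0\<close>.\<close>
  have "(s / R)\<^sup>2 + (c / R)\<^sup>2 = 1"
    unfolding power_divide add_divide_distrib[symmetric] R(2)[symmetric] using R(1) by simp
  from max[OF this] have "s / R * s + c / R * c \<le> s" by (simp add: inner_add_left s_def c_def)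
  moreover have "s / R * s + c / R * c = R"
    using R by (simp add: field_simps power2_eq_square)
  ultimately have "R \<le> s" by simp
  then have "R\<^sup>2 \<le> s\<^sup>2" using R by (intro power_mono) auto
  with R c show False by simp
qed

text \<open>The body of \<open>principal_angles\<close> with the vectors and their number made
  explicit, so that the roles of the two subspaces can be exchanged.\<close>

definition principal_system ::
  "'a::euclidean_space set \<Rightarrow> 'a set \<Rightarrow> nat \<Rightarrow> (nat \<Rightarrow> real) \<Rightarrow> (nat \<Rightarrow> 'a) \<Rightarrow> (nat \<Rightarrow> 'a) \<Rightarrow> bool" where
  "principal_system U W r \<theta> u w \<longleftrightarrow>
     (\<forall>j\<in>{1..r}.
        \<theta> j \<in> {0..pi / 2} \<and> cos (\<theta> j) = u j \<bullet> w j \<and>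
        u j \<in> U \<and> norm (u j) = 1 \<and> (\<forall>i\<in>{1..<j}. u i \<bullet> u j = 0) \<and>
        w j \<in> W \<and> norm (w j) = 1 \<and> (\<forall>i\<in>{1..<j}. w i \<bullet> w j = 0) \<and>
        (\<forall>x\<in>U. \<forall>y\<in>W. norm x = 1 \<longrightarrow> norm y = 1 \<longrightarrow>
           (\<forall>i\<in>{1..<j}. u i \<bullet> x = 0 \<and> w i \<bullet> y = 0) \<longrightarrow> x \<bullet> y \<le> u j \<bullet> w j))"

lemma principal_angles_iff: "principal_angles U W \<theta> \<longleftrightarrow> (\<exists>u w. principal_system U W (min (dim U) (dim W)) \<theta> u w)"
  unfolding principal_angles_def principal_system_def ..

text \<open>Every fact about the projection to \<open>U\<close> thereby holds for \<open>W\<close>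
  too, which is how the singular relations for B and for its transpose are obtained
  together.\<close>

lemma principal_system_commute:
  assumes "principal_system U W r \<theta> u w"
  shows "principal_system W U r \<theta> w u"
  unfolding principal_system_def
proof (rule ballI)
  fix j assume "j \<in> {1..r}"
  note J = bspec[OF assms[unfolded principal_system_def] this]
  have "x \<bullet> y \<le> w j \<bullet> u j"
    if "x \<in> W" "y \<in> U" "norm x = 1" "norm y = 1" "\<forall>i\<in>{1..<j}. w i \<bullet> x = 0 \<and> u i \<bullet> y = 0" for x y
    using J that unfolding inner_commute[of x y] inner_commute[of "w j" "u j"] by blast
  then show "\<theta> j \<in> {0..pi / 2} \<and> cos (\<theta> j) = w j \<bullet> u j \<and>
        w j \<in> W \<and> norm (w j) = 1 \<and> (\<forall>i\<in>{1..<j}. w i \<bullet> w j = 0) \<and>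
        u j \<in> U \<and> norm (u j) = 1 \<and> (\<forall>i\<in>{1..<j}. u i \<bullet> u j = 0) \<and>
        (\<forall>x\<in>W. \<forall>y\<in>U. norm x = 1 \<longrightarrow> norm y = 1 \<longrightarrow>
           (\<forall>i\<in>{1..<j}. w i \<bullet> x = 0 \<and> u i \<bullet> y = 0) \<longrightarrow> x \<bullet> y \<le> w j \<bullet> u j)"
    using J by (simp add: inner_commute[of "w j" "u j"])
qed

lemma principal_system_orthonormal:
  assumes "principal_system U W r \<theta> u w" "i \<in> {1..r}" "j \<in> {1..r}"
  shows "u i \<bullet> u j = (if i = j then 1 else 0)"
proof -
  have "u i \<bullet> u j = 0" if "i < j" "i \<in> {1..r}" "j \<in> {1..r}" for i j
    using assms(1) that by (auto simp: principal_system_def)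
  moreover have "u j \<bullet> u j = 1"
    using assms by (auto simp: principal_system_def norm_eq_1)
  ultimately show ?thesis using assms(2,3) by (metis inner_commute linorder_neqE_nat)
qed

text \<open>Turning \<open>u j\<close> towards the direction of \<open>x\<close> stays within the
  competitors of step \<open>j\<close>, with \<open>w j\<close> held fixed. Since \<open>u j\<close>
  is maximal among them, \<open>w j\<close> has no component along \<open>x\<close>.\<close>

lemma principal_system_residual:
  assumes ps: "principal_system U W r \<theta> u w" and U: "subspace U" and j: "j \<in> {1..r}"
    and x: "x \<in> U" and orth: "\<And>i. i \<in> {1..j} \<Longrightarrow> u i \<bullet> x = 0"
  shows "x \<bullet> w j = 0"
proof (cases "x = 0")
  case False
  let ?x = "x /\<^sub>R norm x"
  have J: "u j \<in> U" "norm (u j) = 1" "w j \<in> W" "norm (w j) = 1"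
    "\<And>i. i \<in> {1..<j} \<Longrightarrow> u i \<bullet> u j = 0" "\<And>i. i \<in> {1..<j} \<Longrightarrow> w i \<bullet> w j = 0"
    "\<And>x. x \<in> U \<Longrightarrow> norm x = 1 \<Longrightarrow> (\<And>i. i \<in> {1..<j} \<Longrightarrow> u i \<bullet> x = 0) \<Longrightarrow> x \<bullet> w j \<le> u j \<bullet> w j"
    using ps j unfolding principal_system_def by blast+
  have ux: "u i \<bullet> ?x = 0" if "i \<in> {1..j}" for i using orth[OF that] by simp
  have nx: "norm ?x = 1" using False by simp
  have ujx: "u j \<bullet> ?x = 0" using j by (intro ux) auto
  have "?x \<bullet> w j = 0"
  proof (rule extremal_inner_orthogonal[OF J(2) nx ujx])
    fix a b :: real assume ab: "a\<^sup>2 + b\<^sup>2 = 1"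
    show "(a *\<^sub>R u j + b *\<^sub>R ?x) \<bullet> w j \<le> u j \<bullet> w j"
    proof (rule J(7))
      show "a *\<^sub>R u j + b *\<^sub>R ?x \<in> U" using U J(1) x by (intro subspace_add subspace_scale)
      have "(norm (a *\<^sub>R u j + b *\<^sub>R ?x))\<^sup>2 = (norm (a *\<^sub>R u j))\<^sup>2 + (norm (b *\<^sub>R ?x))\<^sup>2"
        using orth[of j] j by (intro norm_add_Pythagorean) (simp add: orthogonal_def)
      also have "\<dots> = 1" using ab J(2) nx by (simp only: norm_scaleR power_mult_distrib power2_abs) simp
      finally show "norm (a *\<^sub>R u j + b *\<^sub>R ?x) = 1"
        by (intro power2_eq_imp_eq[where y = 1]) simp_all
      fix i assume "i \<in> {1..<j}"
      then show "u i \<bullet> (a *\<^sub>R u j + b *\<^sub>R ?x) = 0" using J(5) ux[of i] by (simp only: inner_add_right inner_scaleR_right) simp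
    qed
  qed
  then show ?thesis using False by simp
qed simp

text \<open>Maximality makes \<open>cos (\<theta> j) u j\<close> the orthogonal projection of \<open>w j\<close> to \<open>U\<close>.\<close>

lemma principal_system_projection:
  assumes ps: "principal_system U W r \<theta> u w" and U: "subspace U" and W: "subspace W"
    and j: "j \<in> {1..r}" and x: "x \<in> U"
  shows "x \<bullet> w j = cos (\<theta> j) * (x \<bullet> u j)"
proof -
  note on = principal_system_orthonormal[OF ps]
  have inU: "u i \<in> U" if "i \<in> {1..r}" for i using ps that by (auto simp: principal_system_def)
  \<comment> \<open>For \<open>i < j\<close> the residual lemma is used at stage \<open>i\<close>
    with the subspaces exchanged: \<open>w j\<close> is orthogonal to the first \<open>i\<close>
    vectors \<open>w\<close>, hence to \<open>u i\<close>.\<close>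
  have "u i \<bullet> w j = 0" if i: "i \<in> {1..<j}" for i
  proof -
    have ij: "i \<in> {1..r}" using i j by auto
    have "w j \<bullet> u i = 0"
    proof (rule principal_system_residual[OF principal_system_commute[OF ps] W ij])
      show "w j \<in> W" using ps j by (auto simp: principal_system_def)
      fix k assume "k \<in> {1..i}"
      then show "w k \<bullet> w j = 0" using i j by (subst principal_system_orthonormal[OF principal_system_commute[OF ps]]) auto
    qed
    then show ?thesis by (simp add: inner_commute)
  qed
  then have uw: "u i \<bullet> w j = (if i = j then cos (\<theta> j) else 0)" if "i \<in> {1..j}" for i
    using that ps j by (auto simp: principal_system_def)
  \<comment> \<open>Subtracting the components along the first \<open>j\<close> vectors
    \<open>u\<close> makes the residual lemma applicable; of the subtracted terms only the one at
    \<open>j\<close> meets \<open>w j\<close>.\<close>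
  define x' where "x' = x - (\<Sum>i=1..j. (x \<bullet> u i) *\<^sub>R u i)"
  have "x' \<bullet> w j = 0"
  proof (rule principal_system_residual[OF ps U j])
    show "x' \<in> U" unfolding x'_def using j by (intro subspace_diff U x subspace_sum subspace_scale inU) auto
    fix k assume k: "k \<in> {1..j}"
    have "u k \<bullet> x' = u k \<bullet> x - (\<Sum>i=1..j. (x \<bullet> u i) * (u k \<bullet> u i))"
      by (simp add: x'_def inner_diff_right inner_sum_right)
    also have "(\<Sum>i=1..j. (x \<bullet> u i) * (u k \<bullet> u i)) = (\<Sum>i=1..j. if k = i then x \<bullet> u k else 0)"
      using j k by (intro sum.cong refl) (subst on, auto)
    also have "\<dots> = x \<bullet> u k" using k by simp
    finally show "u k \<bullet> x' = 0" by (simp add: inner_commute)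
  qed
  then have "x \<bullet> w j = (\<Sum>i=1..j. (x \<bullet> u i) * (u i \<bullet> w j))"
    by (simp add: x'_def inner_diff_left inner_sum_left)
  also have "\<dots> = (\<Sum>i=1..j. if i = j then cos (\<theta> j) * (x \<bullet> u j) else 0)"
    by (intro sum.cong refl) (simp add: uw)
  also have "\<dots> = cos (\<theta> j) * (x \<bullet> u j)" using j by simp
  finally show ?thesis .
qed

section \<open>From principal angles to singular values\<close>

lemma isometry_matrix:
  fixes A :: "real^'d^'n"
  assumes A: "transpose A ** A = mat 1"
  shows isometry_transpose_mult: "transpose A *v (A *v z) = z"
    and isometry_inner: "(A *v z) \<bullet> (A *v z') = z \<bullet> z'"
    and isometry_col_space: "col_space A = range ((*v) A)"
    and isometry_dim: "dim (col_space A) = CARD('d)"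
proof -
  show 1: "transpose A *v (A *v z) = z" for z by (simp add: A matrix_vector_mul_assoc)
  then show "(A *v z) \<bullet> (A *v z') = z \<bullet> z'" by (simp add: inner_matrix_vector)
  show c: "col_space A = range ((*v) A)"
  proof
    show "range ((*v) A) \<subseteq> col_space A" by (auto simp: col_space_def matrix_vector_mult_in_columnspace)
    have "columns A \<subseteq> range ((*v) A)"
      by (auto simp: columns_def simp flip: matrix_vector_mult_basis)
    then show "col_space A \<subseteq> range ((*v) A)"
      unfolding col_space_def by (intro span_minimal linear_subspace_image) auto
  qed
  have "inj ((*v) A)" by (rule inj_on_inverseI) (rule 1)
  then show "dim (col_space A) = CARD('d)"
    unfolding c using dim_image_eq[of "(*v) A" UNIV] by simp
qed

text \<open>A thin singular value decomposition, written as the action of B and its transpose on the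
  singular vectors. As \<open>r\<close> is the smaller dimension, one of the two families is a full
  orthonormal basis; proofs that need a basis split on which one.\<close>

locale singular_system =
  fixes B :: "real^'d^'l" and s :: "nat \<Rightarrow> real" and a :: "nat \<Rightarrow> real^'l" and b :: "nat \<Rightarrow> real^'d" and r :: nat
  assumes r: "r = min CARD('d) CARD('l)"
    and a: "\<And>i j. i \<in> {1..r} \<Longrightarrow> j \<in> {1..r} \<Longrightarrow> a i \<bullet> a j = (if i = j then 1 else 0)"
    and b: "\<And>i j. i \<in> {1..r} \<Longrightarrow> j \<in> {1..r} \<Longrightarrow> b i \<bullet> b j = (if i = j then 1 else 0)"
    and Bb: "\<And>j. j \<in> {1..r} \<Longrightarrow> B *v b j = s j *\<^sub>R a j"
    and Bta: "\<And>j. j \<in> {1..r} \<Longrightarrow> transpose B *v a j = s j *\<^sub>R b j"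
begin

lemma frob2_eq: "frob2 B = (\<Sum>j=1..r. (s j)\<^sup>2)"
proof (cases "CARD('d) \<le> CARD('l)")
  case True
  then have r': "r = CARD('d)" using r by simp
  have "frob2 B = (\<Sum>j=1..r. (norm (B *v b j))\<^sup>2)"
    unfolding r' by (rule frob2_orthonormal) (rule b[unfolded r'])
  also have "\<dots> = (\<Sum>j=1..r. (s j)\<^sup>2)"
    using a by (intro sum.cong refl) (simp add: Bb norm_eq_sqrt_inner power_mult_distrib)
  finally show ?thesis .
next
  case False
  then have r': "r = CARD('l)" using r by simp
  have "frob2 (transpose B) = (\<Sum>j=1..r. (norm (transpose B *v a j))\<^sup>2)"
    unfolding r' by (rule frob2_orthonormal) (rule a[unfolded r'])
  also have "\<dots> = (\<Sum>j=1..r. (s j)\<^sup>2)"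
    using b by (intro sum.cong refl) (simp add: Bta norm_eq_sqrt_inner power_mult_distrib)
  finally show ?thesis by (simp add: frob2_transpose)
qed

lemma s_nonzero:
  assumes rank: "rank B = r" and j: "j \<in> {1..r}"
  shows "s j \<noteq> 0"
proof (cases "CARD('d) \<le> CARD('l)")
  case True
  then have "inj ((*v) B)" using rank r by (simp add: full_rank_injective)
  moreover have "b j \<noteq> 0" using b[OF j j] by auto
  ultimately have "B *v b j \<noteq> 0" by (metis injD matrix_vector_mult_0_right)
  then show ?thesis using Bb[OF j] by auto
next
  case False
  then have "inj ((*v) (transpose B))" using rank r by (simp add: rank_transpose flip: full_rank_injective)
  moreover have "a j \<noteq> 0" using a[OF j j] by auto
  ultimately have "transpose B *v a j \<noteq> 0" by (metis injD matrix_vector_mult_0_right)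
  then show ?thesis using Bta[OF j] by auto
qed

text \<open>The candidate inverts the singular values along the singular vectors. Composed with B on
  either side it is the orthogonal projection to the span of one family, which makes the symmetry
  conditions of \<open>is_pinv\<close> visible.\<close>

lemma pinv_mult:
  assumes rank: "rank B = r"
  shows "pinv B *v y = (\<Sum>j=1..r. ((a j \<bullet> y) / s j) *\<^sub>R b j)"
    and "is_pinv B (pinv B)"
proof -
  note s = s_nonzero[OF rank]
  let ?f = "\<lambda>y. \<Sum>j=1..r. ((a j \<bullet> y) / s j) *\<^sub>R b j"
  have "linear ?f"
    by (intro linearI) (simp_all add: inner_add_right add_divide_distrib scaleR_add_left sum.distrib scaleR_sum_right)
  then have P: "matrix ?f *v y = ?f y" for y by (intro matrix_works) (simp only: linear_matrix_vector_mul_eq)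
  have fB: "?f (B *v x) = (\<Sum>j=1..r. (x \<bullet> b j) *\<^sub>R b j)" for x
  proof (intro sum.cong refl)
    fix j assume j: "j \<in> {1..r}"
    have "a j \<bullet> (B *v x) = s j * (b j \<bullet> x)" 
      using inner_matrix_vector[of B x "a j"] by (simp add: Bta[OF j] inner_commute)
    then show "((a j \<bullet> (B *v x)) / s j) *\<^sub>R b j = (x \<bullet> b j) *\<^sub>R b j" using s[OF j] by (simp add: inner_commute)
  qed
  have Bf: "B *v ?f y = (\<Sum>j=1..r. (y \<bullet> a j) *\<^sub>R a j)" for y
    unfolding linear_sum[OF matrix_vector_mul_linear] matrix_vector_mult_scaleR
    by (intro sum.cong refl) (simp add: Bb s inner_commute[of y])
  \<comment> \<open>If \<open>b\<close> is a basis the inner projection is the identity; otherwise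
    \<open>a\<close> is a basis and the outer one is.\<close>
  have BfB: "B *v ?f (B *v x) = B *v x" for x
  proof (cases "CARD('d) \<le> CARD('l)")
    case True
    then have r': "r = CARD('d)" using r by simp
    have "(\<Sum>j=1..r. (x \<bullet> b j) *\<^sub>R b j) = x"
      unfolding r' by (rule orthonormal_family_expand) (rule b[unfolded r'])
    then show ?thesis unfolding fB by simp
  next
    case False
    then have r': "r = CARD('l)" using r by simp
    show ?thesis unfolding Bf unfolding r' by (rule orthonormal_family_expand) (rule a[unfolded r'])
  qed
  have fBf: "?f (B *v ?f y) = ?f y" for y
  proof (intro sum.cong refl)
    fix j assume j: "j \<in> {1..r}"
    have "a j \<bullet> (B *v ?f y) = (\<Sum>i=1..r. (y \<bullet> a i) * (a j \<bullet> a i))"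
      unfolding Bf by (simp add: inner_sum_right)
    also have "\<dots> = (\<Sum>i=1..r. if j = i then y \<bullet> a j else 0)"
      using j by (intro sum.cong refl) (simp add: a)
    also have "\<dots> = a j \<bullet> y" using j by (simp add: inner_commute)
    finally show "((a j \<bullet> (B *v ?f y)) / s j) *\<^sub>R b j = ((a j \<bullet> y) / s j) *\<^sub>R b j" by simp
  qed
  have "B ** matrix ?f ** B = B" "matrix ?f ** B ** matrix ?f = matrix ?f"
    unfolding matrix_eq by (simp_all only: matrix_vector_mul_assoc[symmetric] P BfB fBf simp_thms)
  moreover have "transpose (B ** matrix ?f) = B ** matrix ?f"
    unfolding transpose_eq_self_iff matrix_vector_mul_assoc[symmetric] P Bf
    by (simp add: inner_sum_left inner_sum_right inner_commute mult.commute)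
  moreover have "transpose (matrix ?f ** B) = matrix ?f ** B"
    unfolding transpose_eq_self_iff matrix_vector_mul_assoc[symmetric] P fB
    by (simp add: inner_sum_left inner_sum_right inner_commute mult.commute)
  ultimately have "is_pinv B (matrix ?f)" unfolding is_pinv_def by blast
  from pinv_eqI[OF this] this P show "pinv B *v y = ?f y" "is_pinv B (pinv B)" by simp_all
qed

end

text \<open>The principal vectors are pulled back through the isometries \<open>V\<close> and
  \<open>A\<close>. That the projection of \<open>w j\<close> to the column space of
  \<open>V\<close> is the cosine times \<open>u j\<close> becomes the relation for B, and the
  mirrored projection the one for its transpose.\<close>

lemma singular_system_principal:
  fixes V :: "real^'l^'n" and A :: "real^'d^'n"
  assumes V: "transpose V ** V = mat 1" and A: "transpose A ** A = mat 1"
    and angles: "principal_angles (col_space V) (col_space A) \<theta>"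
  defines "r \<equiv> min CARD('d) CARD('l)"
  shows "\<exists>a b. singular_system (transpose V ** A) (\<lambda>j. cos (\<theta> j)) a b r"
proof -
  obtain u w where "principal_system (col_space V) (col_space A) (min (dim (col_space V)) (dim (col_space A))) \<theta> u w"
    using angles unfolding principal_angles_iff by blast
  then have ps: "principal_system (col_space V) (col_space A) r \<theta> u w"
    unfolding isometry_dim[OF A] isometry_dim[OF V] r_def by (simp add: min.commute)
  note ps' = principal_system_commute[OF ps]
  have U: "subspace (col_space V)" "subspace (col_space A)" by (simp_all add: col_space_def)
  define a where "a j = transpose V *v u j" for j
  define b where "b j = transpose A *v w j" for j
  have Va: "V *v a j = u j" if "j \<in> {1..r}" for j
  proof -
    have "u j \<in> range ((*v) V)" using ps that isometry_col_space[OF V] by (auto simp: principal_system_def)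
    then show ?thesis by (auto simp: a_def isometry_transpose_mult[OF V])
  qed
  have Ab: "A *v b j = w j" if "j \<in> {1..r}" for j
  proof -
    have "w j \<in> range ((*v) A)" using ps that isometry_col_space[OF A] by (auto simp: principal_system_def)
    then show ?thesis by (auto simp: b_def isometry_transpose_mult[OF A])
  qed
  have Vx: "V *v x \<in> col_space V" and Ay: "A *v y \<in> col_space A" for x y
    by (auto simp: isometry_col_space[OF A] isometry_col_space[OF V])
  have "singular_system (transpose V ** A) (\<lambda>j. cos (\<theta> j)) a b r"
  proof
    show "r = min CARD('d) CARD('l)" by (rule r_def[THEN meta_eq_to_obj_eq])
    fix i j assume ij: "i \<in> {1..r}" "j \<in> {1..r}"
    show "a i \<bullet> a j = (if i = j then 1 else 0)"
      using principal_system_orthonormal[OF ps ij] ij by (metis Va isometry_inner[OF V])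
    show "b i \<bullet> b j = (if i = j then 1 else 0)"
      using principal_system_orthonormal[OF ps' ij] ij by (metis Ab isometry_inner[OF A])
  next
    fix j assume j: "j \<in> {1..r}"
    have "x \<bullet> (transpose V *v w j) = x \<bullet> (cos (\<theta> j) *\<^sub>R a j)" for x
      using principal_system_projection[OF ps U j Vx[of x]]
      by (simp add: inner_matrix_vector a_def)
    then have "transpose V *v w j = cos (\<theta> j) *\<^sub>R a j" using vector_eq_ldot by blast
    then show "(transpose V ** A) *v b j = cos (\<theta> j) *\<^sub>R a j"
      by (simp add: Ab[OF j] flip: matrix_vector_mul_assoc)
    have "x \<bullet> (transpose A *v u j) = x \<bullet> (cos (\<theta> j) *\<^sub>R b j)" for x
      using principal_system_projection[OF ps' U(2,1) j Ay[of x]]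
      by (simp add: inner_matrix_vector b_def)
    then have "transpose A *v u j = cos (\<theta> j) *\<^sub>R b j" using vector_eq_ldot by blast
    then show "transpose (transpose V ** A) *v a j = cos (\<theta> j) *\<^sub>R b j"
      by (simp add: Va[OF j] matrix_transpose_mul transpose_transpose flip: matrix_vector_mul_assoc)
  qed
  then show ?thesis by blast
qed

section \<open>The comparator risk at a fixed time\<close>

lemma continuous_on_outer: "continuous_on UNIV (\<lambda>u :: real^'n. outer u u)"
  unfolding outer_def by (intro continuous_intros)

lemma norm_outer_le: "norm (outer u u) \<le> CARD('n) * (norm (u :: real^'n))\<^sup>2"
proof -
  have row: "outer u u $ i = (u $ i) *\<^sub>R u" for i by (simp add: outer_def vec_eq_iff)
  have "norm (outer u u) \<le> (\<Sum>i\<in>UNIV. norm (outer u u $ i))"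
    unfolding norm_vec_def[of "outer u u"] by (rule L2_set_le_sum) simp
  also have "\<dots> \<le> (\<Sum>i\<in>(UNIV :: 'n set). (norm u)\<^sup>2)"
    by (intro sum_mono) (simp add: row power2_eq_square component_le_norm_cart mult_right_mono)
  finally show ?thesis by simp
qed

lemma integrable_outer:
  fixes f :: "'a \<Rightarrow> real^'n"
  assumes [measurable]: "f \<in> borel_measurable \<mu>" and int: "integrable \<mu> (\<lambda>x. (norm (f x))\<^sup>2)"
  shows "integrable \<mu> (\<lambda>x. outer (f x) (f x))"
proof (rule Bochner_Integration.integrable_bound)
  show "integrable \<mu> (\<lambda>x. real CARD('n) * (norm (f x))\<^sup>2)" using int by simp
  show "(\<lambda>x. outer (f x) (f x)) \<in> borel_measurable \<mu>"
    by (rule measurable_compose[OF assms(1) borel_measurable_continuous_onI[OF continuous_on_outer]])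
qed (use norm_outer_le in auto)

text \<open>\<open>second_moment\<close> is a Bochner integral of matrices and collapses to 0
  without integrability, so reading it entry by entry rests on \<open>int\<close>.\<close>

lemma
  fixes f :: "'a \<Rightarrow> real^'n"
  assumes int: "integrable \<mu> (\<lambda>x. outer (f x) (f x))"
  shows second_moment_nth: "second_moment \<mu> f $ i $ j = (\<integral>x. f x $ i * f x $ j \<partial>\<mu>)"
    and integrable_nth_mult: "integrable \<mu> (\<lambda>x. f x $ i * f x $ j)"
proof -
  have bl: "bounded_linear (\<lambda>M :: real^'n^'n. M $ i $ j)"
    by (intro bounded_linear_compose[OF bounded_linear_vec_nth] bounded_linear_vec_nth)
  show "second_moment \<mu> f $ i $ j = (\<integral>x. f x $ i * f x $ j \<partial>\<mu>)"
    unfolding second_moment_def using integral_bounded_linear[OF bl int] by (simp add: outer_def)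
  show "integrable \<mu> (\<lambda>x. f x $ i * f x $ j)"
    using integrable_bounded_linear[OF bl int] by (simp add: outer_def)
qed

lemma trace_mult_second_moment:
  fixes f :: "'a \<Rightarrow> real^'n" and Q :: "real^'n^'n"
  assumes int: "integrable \<mu> (\<lambda>x. outer (f x) (f x))"
  shows "trace (Q ** second_moment \<mu> f) = (\<integral>x. f x \<bullet> (Q *v f x) \<partial>\<mu>)"
proof -
  have "f x \<bullet> (Q *v f x) = (\<Sum>i\<in>UNIV. \<Sum>k\<in>UNIV. Q $ i $ k * (f x $ k * f x $ i))" for x
    by (simp add: inner_vec_def matrix_vector_mult_def sum_distrib_left ac_simps)
  moreover have "(\<integral>x. (\<Sum>i\<in>UNIV. \<Sum>k\<in>UNIV. Q $ i $ k * (f x $ k * f x $ i)) \<partial>\<mu>)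
    = (\<Sum>i\<in>UNIV. \<Sum>k\<in>UNIV. Q $ i $ k * second_moment \<mu> f $ k $ i)"
    by (simp add: integrable_nth_mult[OF int] second_moment_nth[OF int])
  ultimately show ?thesis by (simp add: trace_def matrix_matrix_mult_def)
qed

lemma integral_inner_power2_le_lambda_max:
  fixes f :: "'a \<Rightarrow> real^'n"
  assumes int: "integrable \<mu> (\<lambda>x. outer (f x) (f x))"
  shows "(\<integral>x. (w \<bullet> f x)\<^sup>2 \<partial>\<mu>) \<le> lambda_max (second_moment \<mu> f) * (norm w)\<^sup>2"
proof -
  have sym: "transpose (second_moment \<mu> f) = second_moment \<mu> f"
    by (simp add: vec_eq_iff transpose_def second_moment_nth[OF int] mult.commute)
  have "(w \<bullet> f x)\<^sup>2 = (\<Sum>i\<in>UNIV. \<Sum>k\<in>UNIV. w $ i * w $ k * (f x $ i * f x $ k))" for x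
    unfolding power2_eq_square inner_vec_def sum_product by (simp add: ac_simps)
  then have "(\<integral>x. (w \<bullet> f x)\<^sup>2 \<partial>\<mu>) = (\<Sum>i\<in>UNIV. \<Sum>k\<in>UNIV. w $ i * w $ k * second_moment \<mu> f $ i $ k)"
    by (simp add: integrable_nth_mult[OF int] second_moment_nth[OF int])
  also have "\<dots> = w \<bullet> (second_moment \<mu> f *v w)"
    by (simp add: inner_vec_def matrix_vector_mult_def sum_distrib_left ac_simps)
  also have "\<dots> \<le> lambda_max (second_moment \<mu> f) * (norm w)\<^sup>2"
    by (rule quadratic_form_le_lambda_max[OF sym])
  finally show ?thesis .
qed

text \<open>The parallelogram identity with one square dropped; the source of the factors 2 in the
  risk bound.\<close>

lemma norm_diff_power2_le: "(norm (x - y :: 'z::real_inner))\<^sup>2 \<le> 2 * (norm x)\<^sup>2 + 2 * (norm y)\<^sup>2"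
proof -
  have "(norm (x - y))\<^sup>2 + (norm (x + y))\<^sup>2 = 2 * (norm x)\<^sup>2 + 2 * (norm y)\<^sup>2"
    unfolding power2_norm_eq_inner
    by (simp add: inner_add_left inner_add_right inner_diff_left inner_diff_right inner_commute)
  then show ?thesis using zero_le_power2[of "norm (x + y)"] by linarith
qed

text \<open>A single time \<open>t\<close> is fixed, and \<open>L\<close> stands for the value of
  \<open>Lg\<close> there.\<close>

locale comparator_model = latent_model p A \<sigma> P
  for p :: "real^'d \<Rightarrow> real" and A :: "real^'d^'n" and \<sigma> P +
  fixes V :: "real^'l^'n" and t L :: real
  assumes t: "t > 0" and V: "transpose V ** V = mat 1"
    and lip: "L-lipschitz_on UNIV (\<lambda>y. g_map \<sigma> p y t)"
begin

abbreviation "ht \<equiv> htilde \<sigma> t"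
abbreviation "hh \<equiv> fwd_h t"
abbreviation "law \<equiv> fwd_law P t"
abbreviation "g \<equiv> \<lambda>y. g_map \<sigma> p y t"
abbreviation "B \<equiv> transpose V ** A"

interpretation prob_space law by (rule prob_space_N[OF t])

section \<open>Splitting the score error along the column space of V\<close>

definition perp :: "real^'n \<Rightarrow> real^'n" where "perp x = x - V *v (transpose V *v x)"

definition c :: real where "c = \<sigma>\<^sup>2 * (fwd_alpha t)\<^sup>2 / ht"

lemma sets_law [measurable_cong]: "sets law = sets borel"
  by (rule sets_N[OF t])

lemma ht: "ht > 0" and hh: "hh > 0"
  using t by (simp_all add: htilde_pos fwd_h_pos)

lemma c_eq: "c = 1 - hh / ht"
  using ht by (simp add: c_def htilde_def field_simps)

lemma L_nonneg: "L \<ge> 0"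
  using lip by (rule lipschitz_on_nonneg)

lemma VtV [simp]: "transpose V *v (V *v z) = z"
  by (rule isometry_transpose_mult[OF V])

lemma inner_V: "(V *v z) \<bullet> x = z \<bullet> (transpose V *v x)"
  by (rule inner_matrix_vector)

lemma norm_V [simp]: "norm (V *v z) = norm z"
  by (simp add: norm_eq_sqrt_inner inner_V)

lemma Vt_perp [simp]: "transpose V *v perp x = 0"
  by (simp add: perp_def matrix_vector_mult_diff_distrib)

lemma inner_perp_perp: "perp x \<bullet> perp y = perp x \<bullet> y"
  unfolding perp_def[of y] inner_diff_right inner_commute[of _ "V *v _"] inner_V by simp

lemma norm_perp: "(norm (perp x))\<^sup>2 = (norm x)\<^sup>2 - (norm (transpose V *v x))\<^sup>2"
proof -
  have "x \<bullet> (V *v (transpose V *v x)) = (transpose V *v x) \<bullet> (transpose V *v x)"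
    by (simp add: inner_commute[of x] inner_V)
  then have "perp x \<bullet> perp x = x \<bullet> x - (transpose V *v x) \<bullet> (transpose V *v x)"
    unfolding inner_perp_perp by (simp add: perp_def inner_diff_left inner_commute[of "V *v (transpose V *v x)" x])
  then show ?thesis by (simp add: power2_norm_eq_inner)
qed

lemma perp_add: "perp (x + y) = perp x + perp y" and perp_scaleR: "perp (k *\<^sub>R x) = k *\<^sub>R perp x"
  by (simp_all add: perp_def matrix_vector_right_distrib matrix_vector_mult_scaleR algebra_simps)

lemma perp_measurable [measurable]: "perp \<in> borel_measurable borel"
  unfolding perp_def by measurable

lemma g_measurable [measurable]: "g \<in> borel_measurable borel"
  using lip by (intro borel_measurable_continuous_onI lipschitz_on_continuous_on)

lemma resid_inner: "resid x \<bullet> y = x \<bullet> resid y"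
  unfolding resid_def inner_diff_left inner_diff_right inner_commute[of x "A *v _"] inner_A by (simp add: inner_commute)

lemma norm_resid: "(norm (resid x))\<^sup>2 = (norm x)\<^sup>2 - (norm (transpose A *v x))\<^sup>2"
  using pythagoras[of x 0] by simp

text \<open>After scaling by \<open>hh\<close> both scores contain \<open>- x\<close>, which
  cancels. What remains is \<open>V *v (B *v g u) - A *v g y - c *\<^sub>R resid x\<close>, and its
  last two terms are split by the projection \<open>V ** transpose V\<close>, which maps
  \<open>A *v g y\<close> to \<open>V *v (B *v g y)\<close>.\<close>

lemma score_error:
  "hh *\<^sub>R (s_comp \<sigma> p A V x t - grad (\<lambda>u. ln (fwd_density P t u)) x) =
     V *v (B *v (g (pinv B *v (transpose V *v x)) - g (transpose A *v x)) - c *\<^sub>R (transpose V *v resid x))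
     - perp (A *v g (transpose A *v x) + c *\<^sub>R resid x)"
proof -
  let ?y = "transpose A *v x" and ?u = "pinv B *v (transpose V *v x)"
  let ?s = "latent_score \<sigma> p t ?y"
  have "hh *\<^sub>R grad (\<lambda>u. ln (fwd_density P t u)) x = A *v (hh *\<^sub>R ?s) - (hh / ht) *\<^sub>R resid x"
    unfolding grad_ln_fwd_density[OF t] by (simp add: scaleR_diff_right matrix_vector_mult_scaleR)
  also have "hh *\<^sub>R ?s = g ?y - ?y" by (simp add: g_map_def)
  \<comment> \<open>Writing \<open>hh / ht\<close> as \<open>1 - c\<close> completes
    \<open>A *v ?y\<close> to \<open>x\<close>, which is what lets it cancel against the
    comparator's linear term.\<close>
  also have "(hh / ht) *\<^sub>R resid x = resid x - c *\<^sub>R resid x" by (simp add: c_eq algebra_simps)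
  finally have 1: "hh *\<^sub>R grad (\<lambda>u. ln (fwd_density P t u)) x = A *v g ?y - x + c *\<^sub>R resid x"
    by (simp add: matrix_vector_mult_diff_distrib resid_def)
  have 2: "hh *\<^sub>R s_comp \<sigma> p A V x t = V *v (B *v g ?u) - x"
    using hh by (simp add: s_comp_def f_comp_def scaleR_diff_right)
  show ?thesis
    unfolding scaleR_diff_right 1 2 perp_def
    by (simp add: matrix_vector_mult_diff_distrib matrix_vector_right_distrib matrix_vector_mult_scaleR
       flip: matrix_vector_mul_assoc)
qed

text \<open>The last summand has no sign. It is kept exact instead of being estimated because its
  mean vanishes, so the two squares before it carry no factor 2.\<close>

definition bound :: "real^'n \<Rightarrow> real" where
  "bound x = 2 * (op_norm B)\<^sup>2 * L\<^sup>2 * (norm (pinv B *v (transpose V *v x) - transpose A *v x))\<^sup>2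
     + 2 * c\<^sup>2 * (norm (transpose V *v resid x))\<^sup>2
     + (norm (perp (A *v g (transpose A *v x))))\<^sup>2 + c\<^sup>2 * (norm (perp (resid x)))\<^sup>2
     + 2 * c * (perp (A *v g (transpose A *v x)) \<bullet> resid x)"

lemma score_error_le:
  "hh\<^sup>2 * (norm (s_comp \<sigma> p A V x t - grad (\<lambda>u. ln (fwd_density P t u)) x))\<^sup>2 \<le> bound x"
proof -
  let ?y = "transpose A *v x" and ?u = "pinv B *v (transpose V *v x)"
  let ?a = "B *v (g ?u - g ?y)" and ?b = "c *\<^sub>R (transpose V *v resid x)"
  let ?q = "A *v g ?y + c *\<^sub>R resid x"
  have orth: "orthogonal (V *v (?a - ?b)) (- perp ?q)"
    by (simp add: orthogonal_def inner_V)
  have "hh\<^sup>2 * (norm (s_comp \<sigma> p A V x t - grad (\<lambda>u. ln (fwd_density P t u)) x))\<^sup>2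
     = (norm (hh *\<^sub>R (s_comp \<sigma> p A V x t - grad (\<lambda>u. ln (fwd_density P t u)) x)))\<^sup>2"
    by (simp add: power_mult_distrib)
  also have "\<dots> = (norm (V *v (?a - ?b) + - perp ?q))\<^sup>2"
    unfolding score_error by simp
  also have "\<dots> = (norm (?a - ?b))\<^sup>2 + (norm (perp ?q))\<^sup>2"
    unfolding norm_add_Pythagorean[OF orth] by simp
  also have "(norm (?a - ?b))\<^sup>2 \<le> 2 * (norm ?a)\<^sup>2 + 2 * (norm ?b)\<^sup>2" by (rule norm_diff_power2_le)
  also have "(norm ?b)\<^sup>2 = c\<^sup>2 * (norm (transpose V *v resid x))\<^sup>2" by (simp add: power_mult_distrib)
  also have "(norm ?a)\<^sup>2 \<le> (op_norm B * (L * norm (?u - ?y)))\<^sup>2"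
  proof (intro power_mono)
    have "norm ?a \<le> op_norm B * norm (g ?u - g ?y)"
      by (rule onorm[OF matrix_vector_mul_bounded_linear])
    also have "\<dots> \<le> op_norm B * (L * norm (?u - ?y))"
      using lipschitz_onD[OF lip, of ?u ?y]
      by (intro mult_left_mono onorm_pos_le matrix_vector_mul_bounded_linear) (simp add: dist_norm)
    finally show "norm ?a \<le> op_norm B * (L * norm (?u - ?y))" .
  qed simp
  also have "(norm (perp ?q))\<^sup>2 = (norm (perp (A *v g ?y)))\<^sup>2 + c\<^sup>2 * (norm (perp (resid x)))\<^sup>2
      + 2 * c * (perp (A *v g ?y) \<bullet> resid x)"
    unfolding perp_add perp_scaleR inner_perp_perp[symmetric, of "A *v g ?y" "resid x"]
    unfolding power2_norm_eq_inner by (simp add: inner_add_left inner_add_right inner_commute power2_eq_square)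
  finally show ?thesis unfolding bound_def by (simp add: power_mult_distrib algebra_simps)
qed

section \<open>Integrability and averages under the forward law\<close>

lemma integrable_quadratic:
  fixes F :: "real^'n \<Rightarrow> real"
  assumes [measurable]: "F \<in> borel_measurable borel" and F: "\<And>x. \<bar>F x\<bar> \<le> k + m * (norm x)\<^sup>2"
  shows "integrable law F"
proof (rule Bochner_Integration.integrable_bound)
  show "integrable law (\<lambda>x. k + m * (norm x)\<^sup>2)" using integrable_norm2[OF t] by simp
  show "AE x in law. norm (F x) \<le> norm (k + m * (norm x)\<^sup>2)"
    using F by (intro AE_I2) (simp add: order_trans[OF _ abs_ge_self])
qed measurable

lemma integrable_linear_power2:
  fixes f :: "real^'n \<Rightarrow> 'z::euclidean_space"
  assumes "bounded_linear f"
  shows "integrable law (\<lambda>x. (norm (f x))\<^sup>2)"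
proof (rule integrable_quadratic)
  interpret f: bounded_linear f by fact
  have "continuous_on UNIV f" by (rule linear_continuous_on[OF assms])
  then show "(\<lambda>x. (norm (f x))\<^sup>2) \<in> borel_measurable borel"
    by (intro borel_measurable_continuous_onI continuous_intros)
  fix x
  have "(norm (f x))\<^sup>2 \<le> (onorm f * norm x)\<^sup>2" by (intro power_mono onorm[OF assms]) simp
  then show "\<bar>(norm (f x))\<^sup>2\<bar> \<le> 0 + (onorm f)\<^sup>2 * (norm x)\<^sup>2" by (simp add: power_mult_distrib)
qed

lemma bounded_linear_resid: "bounded_linear resid"
  unfolding resid_def by (intro bounded_linear_sub bounded_linear_ident matrix_vector_mul_bounded_linear
    bounded_linear_compose[OF matrix_vector_mul_bounded_linear])

lemma norm_At_le: "norm (transpose A *v x) \<le> norm x"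
  using norm_resid[of x] zero_le_power2[of "norm (resid x)"] by (intro power2_le_imp_le[OF _ norm_ge_zero]) linarith

lemma norm_resid_le: "norm (resid x) \<le> norm x"
  using norm_resid[of x] zero_le_power2[of "norm (transpose A *v x)"] by (intro power2_le_imp_le[OF _ norm_ge_zero]) linarith

lemma norm_perp_le: "norm (perp x) \<le> norm x"
  using norm_perp[of x] zero_le_power2[of "norm (transpose V *v x)"] by (intro power2_le_imp_le[OF _ norm_ge_zero]) linarith

text \<open>A Lipschitz map grows at most linearly, so the second moments that involve
  \<open>g\<close> are finite as soon as those of \<open>x\<close> are.\<close>

lemma norm_g_power2_le: "(norm (g (transpose A *v x)))\<^sup>2 \<le> 2 * (norm (g 0))\<^sup>2 + 2 * L\<^sup>2 * (norm x)\<^sup>2"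
proof -
  have "norm (g (transpose A *v x) - g 0) \<le> L * norm (transpose A *v x)"
    using lipschitz_onD[OF lip, of "transpose A *v x" 0] by (simp add: dist_norm)
  also have "\<dots> \<le> L * norm x" using L_nonneg by (intro mult_left_mono norm_At_le)
  finally have "(norm (g (transpose A *v x) - g 0))\<^sup>2 \<le> (L * norm x)\<^sup>2" by (intro power_mono) auto
  moreover have "(norm (g (transpose A *v x)))\<^sup>2 \<le> 2 * (norm (g (transpose A *v x) - g 0))\<^sup>2 + 2 * (norm (- g 0))\<^sup>2"
    using norm_diff_power2_le[of "g (transpose A *v x) - g 0" "- g 0"] by simp
  ultimately show ?thesis by (simp add: power_mult_distrib)
qed

lemma integrable_g: "integrable law (\<lambda>x. (norm (g (transpose A *v x)))\<^sup>2)"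
  using norm_g_power2_le by (intro integrable_quadratic) auto

lemma integrable_outer_g: "integrable law (\<lambda>x. outer (g (transpose A *v x)) (g (transpose A *v x)))"
  by (intro integrable_outer integrable_g) simp

lemma integrable_outer_y: "integrable law (\<lambda>x. outer (transpose A *v x) (transpose A *v x))"
  by (intro integrable_outer integrable_linear_power2 matrix_vector_mul_bounded_linear) simp

lemma integrable_cross: "integrable law (\<lambda>x. perp (A *v g (transpose A *v x)) \<bullet> resid x)"
proof (rule integrable_quadratic)
  fix x
  let ?g = "g (transpose A *v x)"
  have "\<bar>perp (A *v ?g) \<bullet> resid x\<bar> \<le> norm (perp (A *v ?g)) * norm (resid x)"
    by (rule Cauchy_Schwarz_ineq2)
  also have "\<dots> \<le> norm ?g * norm x"
    using norm_perp_le[of "A *v ?g"] norm_resid_le[of x] by (intro mult_mono) auto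
  also have "\<dots> \<le> (norm ?g)\<^sup>2 + (norm x)\<^sup>2"
    using sum_squares_bound[of "norm ?g" "norm x"] mult_nonneg_nonneg[OF norm_ge_zero[of ?g] norm_ge_zero[of x]]
    unfolding mult.assoc by linarith
  also have "\<dots> \<le> 2 * (norm (g 0))\<^sup>2 + (2 * L\<^sup>2 + 1) * (norm x)\<^sup>2"
    using norm_g_power2_le[of x] by (simp add: algebra_simps)
  finally show "\<bar>perp (A *v ?g) \<bullet> resid x\<bar> \<le> 2 * (norm (g 0))\<^sup>2 + (2 * L\<^sup>2 + 1) * (norm x)\<^sup>2" .
qed simp

lemma integral_cross: "(\<integral>x. perp (A *v g (transpose A *v x)) \<bullet> resid x \<partial>law) = 0"
  by (rule integral_odd[OF t]) simp_all

text \<open>\<open>resid\<close> is a symmetric projection and can be moved onto \<open>w\<close>;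
  the vector \<open>resid w\<close> is orthogonal to the column space of \<open>A\<close>, where the
  variance is known.\<close>

lemma integral_inner_resid: "(\<integral>x. (w \<bullet> resid x)\<^sup>2 \<partial>law) = ht * ((norm w)\<^sup>2 - (norm (transpose A *v w))\<^sup>2)"
proof -
  have "(\<integral>\<^sup>+x. ennreal ((w \<bullet> resid x)\<^sup>2) \<partial>law) = ennreal (ht * (norm (resid w))\<^sup>2)"
    using nn_integral_inner_normal[OF t, of "resid w"] by (simp add: resid_inner)
  then have "(\<integral>x. (w \<bullet> resid x)\<^sup>2 \<partial>law) = ht * (norm (resid w))\<^sup>2"
    using ht by (intro integral_eq_nn_integral[THEN trans]) auto
  then show ?thesis by (simp add: norm_resid)
qed

lemma integrable_inner_resid: "integrable law (\<lambda>x. (w \<bullet> resid x)\<^sup>2)"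
  using integrable_linear_power2[OF bounded_linear_compose[OF bounded_linear_inner_right[of w] bounded_linear_resid]] by simp

lemma frob2_A: "frob2 A = CARD('d)"
  unfolding frob2_columns by (simp add: norm_axis_1)

lemma integral_norm_resid: "(\<integral>x. (norm (resid x))\<^sup>2 \<partial>law) = ht * (CARD('n) - real CARD('d))"
proof -
  have "(\<integral>x. (norm (resid x))\<^sup>2 \<partial>law) = (\<integral>x. (\<Sum>i\<in>UNIV. (axis i 1 \<bullet> resid x)\<^sup>2) \<partial>law)"
    by (simp add: norm2_eq_sum inner_axis')
  also have "\<dots> = (\<Sum>i\<in>UNIV. ht * (1 - (norm (transpose A *v axis i 1))\<^sup>2))"
    by (subst Bochner_Integration.integral_sum) (auto simp: integrable_inner_resid integral_inner_resid norm_axis_1)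
  also have "\<dots> = ht * (CARD('n) - frob2 A)"
    by (simp add: sum_distrib_left[symmetric] sum_subtractf frob2_rows)
  finally show ?thesis by (simp add: frob2_A)
qed

text \<open>Row by row, the vector paired with \<open>resid x\<close> is the unit vector
  \<open>V *v axis i 1\<close>, whose component in the column space of \<open>A\<close> has the norm
  of \<open>transpose B *v axis i 1\<close>.\<close>

lemma integral_norm_Vt_resid: "(\<integral>x. (norm (transpose V *v resid x))\<^sup>2 \<partial>law) = ht * (CARD('l) - frob2 B)"
proof -
  have nth: "(transpose V *v x) $ i = (V *v axis i 1) \<bullet> x" for x i
    by (simp add: inner_V inner_axis')
  have "(\<integral>x. (norm (transpose V *v resid x))\<^sup>2 \<partial>law) = (\<integral>x. (\<Sum>i\<in>UNIV. ((V *v axis i 1) \<bullet> resid x)\<^sup>2) \<partial>law)"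
    by (simp add: norm2_eq_sum nth)
  also have "\<dots> = (\<Sum>i\<in>UNIV. ht * (1 - (norm (transpose B *v axis i 1))\<^sup>2))"
    by (subst Bochner_Integration.integral_sum)
       (auto simp: integrable_inner_resid integral_inner_resid norm_axis_1 matrix_transpose_mul transpose_transpose
         matrix_vector_mul_assoc)
  also have "\<dots> = ht * (CARD('l) - frob2 B)"
    by (simp add: sum_distrib_left[symmetric] sum_subtractf frob2_rows)
  finally show ?thesis .
qed

text \<open>Each row of \<open>?K\<close>, the projection of \<open>A\<close> off the column space
  of \<open>V\<close>, contributes at most the largest eigenvalue times its squared length. The
  squared Frobenius norm of \<open>?K\<close> follows columnwise: a column of \<open>A\<close> has
  length 1 and loses what \<open>V\<close> captures of it.\<close>

lemma integral_perp_A_g: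
  "(\<integral>x. (norm (perp (A *v g (transpose A *v x))))\<^sup>2 \<partial>law)
     \<le> lambda_max (second_moment law (\<lambda>x. g (transpose A *v x))) * (CARD('d) - frob2 B)"
proof -
  let ?lam = "lambda_max (second_moment law (\<lambda>x. g (transpose A *v x)))"
  let ?K = "A - V ** B"
  have K: "perp (A *v z) = ?K *v z" for z
    by (simp add: perp_def matrix_vector_mult_diff_rdistrib matrix_vector_mul_assoc matrix_mul_assoc)
  have nth: "(?K *v z) $ i = (transpose ?K *v axis i 1) \<bullet> z" for z i
    by (simp add: inner_matrix_vector transpose_transpose inner_axis')
  have int: "integrable law (\<lambda>x. (w \<bullet> g (transpose A *v x))\<^sup>2)" for w
  proof (rule Bochner_Integration.integrable_bound)
    show "integrable law (\<lambda>x. (norm w)\<^sup>2 * (norm (g (transpose A *v x)))\<^sup>2)" using integrable_g by simp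
    show "AE x in law. norm ((w \<bullet> g (transpose A *v x))\<^sup>2) \<le> norm ((norm w)\<^sup>2 * (norm (g (transpose A *v x)))\<^sup>2)"
    proof (intro AE_I2)
      fix x
      have "\<bar>w \<bullet> g (transpose A *v x)\<bar>\<^sup>2 \<le> (norm w * norm (g (transpose A *v x)))\<^sup>2"
        by (intro power_mono Cauchy_Schwarz_ineq2) simp
      then show "norm ((w \<bullet> g (transpose A *v x))\<^sup>2) \<le> norm ((norm w)\<^sup>2 * (norm (g (transpose A *v x)))\<^sup>2)"
        by (simp add: power_mult_distrib)
    qed
  qed simp
  have "(\<integral>x. (norm (perp (A *v g (transpose A *v x))))\<^sup>2 \<partial>law)
     = (\<integral>x. (\<Sum>i\<in>UNIV. ((transpose ?K *v axis i 1) \<bullet> g (transpose A *v x))\<^sup>2) \<partial>law)"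
    unfolding K norm2_eq_sum nth ..
  also have "\<dots> = (\<Sum>i\<in>UNIV. (\<integral>x. ((transpose ?K *v axis i 1) \<bullet> g (transpose A *v x))\<^sup>2 \<partial>law))"
    by (rule Bochner_Integration.integral_sum) (rule int)
  also have "\<dots> \<le> (\<Sum>i\<in>UNIV. ?lam * (norm (transpose ?K *v axis i 1))\<^sup>2)"
    by (intro sum_mono integral_inner_power2_le_lambda_max integrable_outer_g)
  also have "\<dots> = ?lam * frob2 ?K" by (simp only: frob2_rows sum_distrib_left)
  also have "frob2 ?K = (\<Sum>j\<in>UNIV. 1 - (norm (B *v axis j 1))\<^sup>2)"
    unfolding frob2_columns K[symmetric] norm_perp by (simp add: matrix_vector_mul_assoc norm_axis_1)
  also have "\<dots> = CARD('d) - frob2 B" by (simp add: sum_subtractf frob2_columns)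
  finally show ?thesis .
qed

section \<open>The latent error in the singular basis\<close>

context
  fixes s a b r
  assumes sys: "singular_system B s a b r" and rank: "rank B = r"
begin

interpretation S: singular_system B s a b r by (rule sys)

abbreviation "Q \<equiv> mat 1 - pinv B ** B"

text \<open>Inserting \<open>transpose V *v x = B *v y + transpose V *v resid x\<close> leaves
  \<open>- (Q *v y)\<close> plus the pseudoinverse applied to noise. \<open>Q\<close> is the
  projection to the kernel of B and annihilates the range of the pseudoinverse, so the two parts are
  orthogonal for every \<open>x\<close>, not just in mean.\<close>

lemma latent_error: "(norm (pinv B *v (transpose V *v x) - transpose A *v x))\<^sup>2
  = (transpose A *v x) \<bullet> (Q *v (transpose A *v x)) + (\<Sum>j=1..r. ((V *v a j) \<bullet> resid x)\<^sup>2 / (s j)\<^sup>2)"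
proof -
  let ?y = "transpose A *v x" and ?z = "transpose V *v resid x"
  have pi: "B ** pinv B ** B = B" "pinv B ** B ** pinv B = pinv B"
    "transpose (pinv B ** B) = pinv B ** B"
    using S.pinv_mult(2)[OF rank] by (auto simp: is_pinv_def)
  have Qz: "Q *v z = z - pinv B *v (B *v z)" for z
    by (simp add: matrix_vector_mult_diff_rdistrib matrix_vector_mul_assoc)
  have symQ: "(Q *v z) \<bullet> z' = z \<bullet> (Q *v z')" for z z'
    using pi(3)[unfolded transpose_eq_self_iff] unfolding Qz matrix_vector_mul_assoc by (simp add: inner_diff_left inner_diff_right)
  have QP: "Q *v (pinv B *v z) = 0" for z
    by (simp only: Qz) (simp add: matrix_vector_mul_assoc matrix_mul_assoc pi(2)[unfolded matrix_mul_assoc])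
  have QQ: "Q *v (Q *v z) = Q *v z" for z
  proof -
    have "Q *v (z - pinv B *v (B *v z)) = Q *v z"
      by (simp only: matrix_vector_mult_diff_distrib QP diff_zero)
    then show ?thesis by (simp only: Qz[of z, symmetric])
  qed
  have "transpose V *v x = B *v ?y + ?z"
    by (subst decomp[of x]) (simp add: matrix_vector_right_distrib matrix_vector_mul_assoc matrix_mul_assoc)
  then have "pinv B *v (transpose V *v x) - ?y = - (Q *v ?y) + pinv B *v ?z"
    by (simp add: Qz matrix_vector_right_distrib)
  moreover have "orthogonal (- (Q *v ?y)) (pinv B *v ?z)"
    by (simp add: orthogonal_def symQ QP)
  ultimately have "(norm (pinv B *v (transpose V *v x) - ?y))\<^sup>2 = (norm (Q *v ?y))\<^sup>2 + (norm (pinv B *v ?z))\<^sup>2"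
    by (simp only: norm_add_Pythagorean norm_minus_cancel)
  also have "(norm (Q *v ?y))\<^sup>2 = ?y \<bullet> (Q *v ?y)"
    unfolding power2_norm_eq_inner symQ QQ ..
  also have "(norm (pinv B *v ?z))\<^sup>2 = (\<Sum>j=1..r. ((V *v a j) \<bullet> resid x)\<^sup>2 / (s j)\<^sup>2)"
  proof -
    have "(norm (\<Sum>j=1..r. ((a j \<bullet> ?z) / s j) *\<^sub>R b j))\<^sup>2 = (\<Sum>j=1..r. ((a j \<bullet> ?z) / s j)\<^sup>2)"
      by (rule norm_orthonormal_sum) (rule S.b)
    then show ?thesis unfolding S.pinv_mult(1)[OF rank] inner_V power_divide .
  qed
  finally show ?thesis .
qed

lemma integrable_latent_error: "integrable law (\<lambda>x. (norm (pinv B *v (transpose V *v x) - transpose A *v x))\<^sup>2)"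
  by (intro integrable_linear_power2 bounded_linear_sub bounded_linear_compose[OF matrix_vector_mul_bounded_linear]
      matrix_vector_mul_bounded_linear)

lemma integral_latent_error:
  "(\<integral>x. (norm (pinv B *v (transpose V *v x) - transpose A *v x))\<^sup>2 \<partial>law)
     = trace (Q ** second_moment law (\<lambda>x. transpose A *v x)) + ht * (\<Sum>j=1..r. 1 / (s j)\<^sup>2 - 1)"
proof -
  have int1: "integrable law (\<lambda>x. ((V *v a j) \<bullet> resid x)\<^sup>2 / (s j)\<^sup>2)" for j
    using integrable_inner_resid by simp
  then have int2: "integrable law (\<lambda>x. \<Sum>j=1..r. ((V *v a j) \<bullet> resid x)\<^sup>2 / (s j)\<^sup>2)"
    by (intro Bochner_Integration.integrable_sum)
  have int3: "integrable law (\<lambda>x. (transpose A *v x) \<bullet> (Q *v (transpose A *v x)))"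
    using Bochner_Integration.integrable_diff[OF integrable_latent_error int2] by (simp add: latent_error)
  \<comment> \<open>The component of \<open>V *v a j\<close> in the column space of \<open>A\<close>
    has length \<open>\<bar>s j\<bar>\<close>, so the noise along it has variance
    \<open>ht * (1 - (s j)\<^sup>2)\<close>. With \<open>s j\<close> a cosine the quotient becomes
    \<open>ht\<close> times the squared tangent.\<close>
  have e: "(\<integral>x. ((V *v a j) \<bullet> resid x)\<^sup>2 / (s j)\<^sup>2 \<partial>law) = ht * (1 / (s j)\<^sup>2 - 1)" if j: "j \<in> {1..r}" for j
  proof -
    have n: "norm (a j) = 1" "norm (b j) = 1" using S.a[OF j j] S.b[OF j j] by (simp_all add: norm_eq_1)
    have "transpose A *v (V *v a j) = transpose B *v a j"
      by (simp add: matrix_transpose_mul transpose_transpose matrix_vector_mul_assoc)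
    then have "(\<integral>x. ((V *v a j) \<bullet> resid x)\<^sup>2 \<partial>law) = ht * (1 - (s j)\<^sup>2)"
      unfolding integral_inner_resid using n by (simp add: S.Bta[OF j])
    then show ?thesis using S.s_nonzero[OF rank j] by (simp add: field_simps)
  qed
  have "(\<integral>x. (norm (pinv B *v (transpose V *v x) - transpose A *v x))\<^sup>2 \<partial>law)
    = (\<integral>x. (transpose A *v x) \<bullet> (Q *v (transpose A *v x)) \<partial>law) + (\<integral>x. (\<Sum>j=1..r. ((V *v a j) \<bullet> resid x)\<^sup>2 / (s j)\<^sup>2) \<partial>law)"
    unfolding latent_error using int3 int2 by (rule Bochner_Integration.integral_add)
  also have "(\<integral>x. (\<Sum>j=1..r. ((V *v a j) \<bullet> resid x)\<^sup>2 / (s j)\<^sup>2) \<partial>law) = (\<Sum>j=1..r. ht * (1 / (s j)\<^sup>2 - 1))"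
    using e by (subst Bochner_Integration.integral_sum) (auto intro: int1)
  finally show ?thesis
    unfolding trace_mult_second_moment[OF integrable_outer_y] sum_distrib_left .
qed

lemma risk_le:
  "(\<integral>\<^sup>+x. ennreal ((norm (s_comp \<sigma> p A V x t - grad (\<lambda>u. ln (fwd_density P t u)) x))\<^sup>2) \<partial>law)
   \<le> ennreal (lambda_max (second_moment law (\<lambda>x. g (transpose A *v x))) / hh\<^sup>2 * (CARD('d) - (\<Sum>j=1..r. (s j)\<^sup>2))
     + 2 * (op_norm B)\<^sup>2 * L\<^sup>2 / hh\<^sup>2 * trace (Q ** second_moment law (\<lambda>x. transpose A *v x))
     + 2 * (op_norm B)\<^sup>2 * ht * L\<^sup>2 / hh\<^sup>2 * (\<Sum>j=1..r. 1 / (s j)\<^sup>2 - 1)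
     + \<sigma> ^ 4 * (fwd_alpha t) ^ 4 / (hh\<^sup>2 * ht) * (real CARD('n) + real CARD('l) - real CARD('d) - (\<Sum>j=1..r. (s j)\<^sup>2)))"
  (is "_ \<le> ennreal ?R")
proof -
  let ?lam = "lambda_max (second_moment law (\<lambda>x. g (transpose A *v x)))"
  let ?tr = "trace (Q ** second_moment law (\<lambda>x. transpose A *v x))"
  let ?F = "\<Sum>j=1..r. (s j)\<^sup>2" and ?T = "\<Sum>j=1..r. 1 / (s j)\<^sup>2 - 1"
  note blm = matrix_vector_mul_bounded_linear
  have i1: "integrable law (\<lambda>x. (norm (transpose V *v resid x))\<^sup>2)"
    and i2: "integrable law (\<lambda>x. (norm (resid x))\<^sup>2)"
    by (intro integrable_linear_power2 bounded_linear_compose[OF blm] bounded_linear_resid)+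
  have i3: "integrable law (\<lambda>x. (norm (perp (A *v g (transpose A *v x))))\<^sup>2)"
  proof (rule Bochner_Integration.integrable_bound[OF integrable_g])
    show "AE x in law. norm ((norm (perp (A *v g (transpose A *v x))))\<^sup>2) \<le> norm ((norm (g (transpose A *v x)))\<^sup>2)"
      using norm_perp_le[of "A *v g _"] by (intro AE_I2) (simp add: power_mono)
  qed simp
  have i4: "integrable law (\<lambda>x. (norm (perp (resid x)))\<^sup>2)" unfolding norm_perp using i1 i2 by simp
  have e4: "(\<integral>x. (norm (perp (resid x)))\<^sup>2 \<partial>law) = ht * (CARD('n) - real CARD('d)) - ht * (CARD('l) - ?F)"
    unfolding norm_perp using i1 i2 by (simp add: integral_norm_resid integral_norm_Vt_resid S.frob2_eq)
  note ints = integrable_latent_error i1 i3 i4 integrable_cross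
  have int: "integrable law bound" unfolding bound_def using ints by simp
  have "(\<integral>x. bound x \<partial>law) = 2 * (op_norm B)\<^sup>2 * L\<^sup>2 * (?tr + ht * ?T) + 2 * c\<^sup>2 * (ht * (CARD('l) - ?F))
     + (\<integral>x. (norm (perp (A *v g (transpose A *v x))))\<^sup>2 \<partial>law)
     + c\<^sup>2 * (ht * (CARD('n) - real CARD('d)) - ht * (CARD('l) - ?F))"
    unfolding bound_def using ints
    by (simp add: integral_latent_error integral_norm_Vt_resid S.frob2_eq e4 integral_cross)
  also have "\<dots> \<le> 2 * (op_norm B)\<^sup>2 * L\<^sup>2 * (?tr + ht * ?T) + 2 * c\<^sup>2 * (ht * (CARD('l) - ?F))
     + ?lam * (CARD('d) - ?F) + c\<^sup>2 * (ht * (CARD('n) - real CARD('d)) - ht * (CARD('l) - ?F))"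
    using integral_perp_A_g unfolding S.frob2_eq by simp
  \<comment> \<open>The noise terms combine: twice the part inside the column space of
    \<open>V\<close> plus the part outside equals the total plus the inner part once.\<close>
  also have "\<dots> = ?lam * (CARD('d) - ?F) + 2 * (op_norm B)\<^sup>2 * L\<^sup>2 * ?tr + 2 * (op_norm B)\<^sup>2 * ht * L\<^sup>2 * ?T
      + (c\<^sup>2 * ht) * (real CARD('n) + real CARD('l) - real CARD('d) - ?F)"
    by (simp add: algebra_simps)
  also have "c\<^sup>2 * ht = \<sigma> ^ 4 * (fwd_alpha t) ^ 4 / ht"
    using ht by (simp add: c_def power_divide power_mult_distrib power2_eq_square flip: power_mult) (simp add: power4_eq_xxxx)
  also have "?lam * (CARD('d) - ?F) + 2 * (op_norm B)\<^sup>2 * L\<^sup>2 * ?tr + 2 * (op_norm B)\<^sup>2 * ht * L\<^sup>2 * ?T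
      + \<sigma> ^ 4 * (fwd_alpha t) ^ 4 / ht * (real CARD('n) + real CARD('l) - real CARD('d) - ?F) = hh\<^sup>2 * ?R"
    using hh by (simp add: distrib_left)
  finally have le: "(\<integral>x. bound x \<partial>law) / hh\<^sup>2 \<le> ?R" using hh by (simp add: pos_divide_le_eq mult.commute)
  have pw: "(norm (s_comp \<sigma> p A V x t - grad (\<lambda>u. ln (fwd_density P t u)) x))\<^sup>2 \<le> bound x / hh\<^sup>2" for x
    using score_error_le[of x] hh by (simp add: pos_le_divide_eq mult.commute)
  have "(\<integral>\<^sup>+x. ennreal ((norm (s_comp \<sigma> p A V x t - grad (\<lambda>u. ln (fwd_density P t u)) x))\<^sup>2) \<partial>law)
     \<le> (\<integral>\<^sup>+x. ennreal (bound x / hh\<^sup>2) \<partial>law)"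
    by (intro nn_integral_mono ennreal_leI pw)
  \<comment> \<open>Nonnegativity of \<open>bound\<close> is not visible from its form; it follows
    since \<open>bound\<close> dominates a square.\<close>
  also have "\<dots> = ennreal (\<integral>x. bound x / hh\<^sup>2 \<partial>law)"
    using int order_trans[OF zero_le_power2 pw] by (intro nn_integral_eq_integral) auto
  also have "\<dots> \<le> ennreal ?R" using le by (intro ennreal_leI) simp
  finally show ?thesis .
qed

end
end

section \<open>Assembly over the time interval\<close>

theorem proposition3:
  fixes M :: "'w measure"
    and z2 :: "'w \<Rightarrow> real ^ 'd2" and eps2 :: "'w \<Rightarrow> real ^ 'D"
    and p2z :: "real ^ 'd2 \<Rightarrow> real" and p2 :: "(real ^ 'D) measure"
    and A2 :: "real ^ 'd2 ^ 'D" and V1 :: "real ^ 'd1 ^ 'D" and B :: "real ^ 'd2 ^ 'd1"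
    and \<theta> :: "nat \<Rightarrow> real" and Lg :: "real \<Rightarrow> real"
    and lam :: "real \<Rightarrow> real" and MY :: "real \<Rightarrow> real ^ 'd2 ^ 'd2"
    and t0 T \<sigma>2 B2 C12 C22 \<beta>2 :: real
  assumes times: "0 < t0" "t0 < T"
    and A2: "transpose A2 ** A2 = mat 1"
    and sigma: "0 < \<sigma>2"
    and M: "prob_space M"
    and z2: "distributed M lborel z2 (\<lambda>z. ennreal (p2z z))"
    and eps2: "distributed M lborel eps2 (\<lambda>x. ennreal (gauss_density 0 (\<sigma>2\<^sup>2) x))"
    and indep: "prob_space.indep_set M
          {z2 -` S \<inter> space M | S. S \<in> sets borel} {eps2 -` S \<inter> space M | S. S \<in> sets borel}"
    and p2: "p2 = distr M borel (\<lambda>\<omega>. A2 *v z2 \<omega> + eps2 \<omega>)"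
    and p2z_pos: "\<And>z. 0 < p2z z"
    and p2z_C2: "twice_cont_differentiable p2z"
    and tail_pos: "0 < B2" "0 < C12" "0 < C22"
    and p2z_tail: "\<And>z. B2 \<le> norm z \<Longrightarrow>
          p2z z \<le> (2 * pi) powr (- real CARD('d2) / 2) * C12 * exp (- C22 * (norm z)\<^sup>2 / 2)"
    and f_star_Lipschitz: "\<And>t. t \<in> {0..T} \<Longrightarrow> \<beta>2-lipschitz_on UNIV (\<lambda>z. f_star \<sigma>2 p2z z t)"
    and V1: "transpose V1 ** V1 = mat 1"
    and B: "B = transpose V1 ** A2"
    and angles: "principal_angles (col_space V1) (col_space A2) \<theta>"
    and Lg: "\<And>t. t \<in> {t0..T} \<Longrightarrow> (Lg t)-lipschitz_on UNIV (\<lambda>y. g_map \<sigma>2 p2z y t)"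
    and lam: "\<And>t. lam t =
          lambda_max (second_moment (fwd_law p2 t) (\<lambda>x. g_map \<sigma>2 p2z (transpose A2 *v x) t))"
    and MY: "\<And>t. MY t = second_moment (fwd_law p2 t) (\<lambda>x. transpose A2 *v x)"
  shows "(CARD('d2) \<le> CARD('d1) \<and> rank B = CARD('d2) \<longrightarrow>
      U_comp p2 t0 T \<sigma>2 p2z A2 V1 \<le>
        ennreal (1 / (T - t0)) *
        (\<integral>\<^sup>+t\<in>{t0..T}. ennreal (
            lam t / (fwd_h t)\<^sup>2 * (\<Sum>j=1..CARD('d2). (sin (\<theta> j))\<^sup>2)
          + 2 * (op_norm B)\<^sup>2 * htilde \<sigma>2 t * (Lg t)\<^sup>2 / (fwd_h t)\<^sup>2
              * (\<Sum>j=1..CARD('d2). (tan (\<theta> j))\<^sup>2)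
          + \<sigma>2 ^ 4 * (fwd_alpha t) ^ 4 / ((fwd_h t)\<^sup>2 * htilde \<sigma>2 t)
              * (real CARD('D) + real CARD('d1) - real CARD('d2)
                  - (\<Sum>j=1..CARD('d2). (cos (\<theta> j))\<^sup>2))) \<partial>lborel))
    \<and> (CARD('d1) < CARD('d2) \<and> rank B = CARD('d1) \<longrightarrow>
      U_comp p2 t0 T \<sigma>2 p2z A2 V1 \<le>
        ennreal (1 / (T - t0)) *
        (\<integral>\<^sup>+t\<in>{t0..T}. ennreal (
            lam t / (fwd_h t)\<^sup>2 * (real CARD('d2) - (\<Sum>j=1..CARD('d1). (cos (\<theta> j))\<^sup>2))
          + 2 * (op_norm B)\<^sup>2 * (Lg t)\<^sup>2 / (fwd_h t)\<^sup>2
              * trace ((mat 1 - pinv B ** B) ** MY t)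
          + 2 * (op_norm B)\<^sup>2 * htilde \<sigma>2 t * (Lg t)\<^sup>2 / (fwd_h t)\<^sup>2
              * (\<Sum>j=1..CARD('d1). (tan (\<theta> j))\<^sup>2)
          + \<sigma>2 ^ 4 * (fwd_alpha t) ^ 4 / ((fwd_h t)\<^sup>2 * htilde \<sigma>2 t)
              * (real CARD('D) + real CARD('d1) - real CARD('d2)
                  - (\<Sum>j=1..CARD('d1). (cos (\<theta> j))\<^sup>2))) \<partial>lborel))"
proof -
  interpret M: prob_space M by (rule M)
  have p_meas: "p2z \<in> borel_measurable borel"
    using borel_measurable_of_ennreal[OF _ less_imp_le[OF p2z_pos]] distributed_borel_measurable[OF z2] by simp
  have p_int: "(\<integral>\<^sup>+z. ennreal (p2z z) \<partial>lborel) = 1"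
    using distributed_emeasure[OF z2, of UNIV] M.emeasure_space_1 by simp
  have p_moment: "(\<integral>\<^sup>+z. ennreal (p2z z * (norm z)\<^sup>2) \<partial>lborel) < \<infinity>"
    using tail_pos p2z_tail
    by (intro gaussian_tail_second_moment[OF p_meas p2z_pos p_int,
          where K = "(2 * pi) powr (- real CARD('d2) / 2) * C12" and c = C22 and b = B2]) auto
  have model: "latent_model p2z A2 \<sigma>2 p2"
  proof
    fix t x assume "(0::real) < t"
    then show "ennreal (fwd_density p2 t x) =
       (\<integral>\<^sup>+z. ennreal (p2z z) * ennreal (gauss_density (fwd_alpha t *\<^sub>R (A2 *v z)) (htilde \<sigma>2 t) x) \<partial>lborel)"
      unfolding p2 by (rule fwd_density_eq_mixture[OF M z2 eps2 indep sigma])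
  qed (fact A2 sigma p2z_pos p_meas p_int p_moment)+
  define r where "r = min CARD('d2) CARD('d1)"
  obtain a b where sys: "singular_system B (\<lambda>j. cos (\<theta> j)) a b r"
    using singular_system_principal[OF V1 A2 angles] unfolding B r_def by blast
  interpret S: singular_system B "\<lambda>j. cos (\<theta> j)" a b r by (rule sys)
  have tan: "(\<Sum>j=1..r. 1 / (cos (\<theta> j))\<^sup>2 - 1) = (\<Sum>j=1..r. (tan (\<theta> j))\<^sup>2)" if "rank B = r"
  proof (intro sum.cong refl)
    fix j assume "j \<in> {1..r}"
    then have "cos (\<theta> j) \<noteq> 0" using S.s_nonzero[OF that] by simp
    then show "1 / (cos (\<theta> j))\<^sup>2 - 1 = (tan (\<theta> j))\<^sup>2"
      by (simp add: tan_def power_divide sin_squared_eq diff_divide_distrib)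
  qed
  \<comment> \<open>One bound covers both regimes, with \<open>r\<close> the smaller dimension; they
    differ only in how the kernel term and the cosine sum simplify.\<close>
  have risk: "U_comp p2 t0 T \<sigma>2 p2z A2 V1 \<le>
        ennreal (1 / (T - t0)) *
        (\<integral>\<^sup>+t\<in>{t0..T}. ennreal (
            lam t / (fwd_h t)\<^sup>2 * (real CARD('d2) - (\<Sum>j=1..r. (cos (\<theta> j))\<^sup>2))
          + 2 * (op_norm B)\<^sup>2 * (Lg t)\<^sup>2 / (fwd_h t)\<^sup>2 * trace ((mat 1 - pinv B ** B) ** MY t)
          + 2 * (op_norm B)\<^sup>2 * htilde \<sigma>2 t * (Lg t)\<^sup>2 / (fwd_h t)\<^sup>2 * (\<Sum>j=1..r. (tan (\<theta> j))\<^sup>2)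
          + \<sigma>2 ^ 4 * (fwd_alpha t) ^ 4 / ((fwd_h t)\<^sup>2 * htilde \<sigma>2 t)
              * (real CARD('D) + real CARD('d1) - real CARD('d2) - (\<Sum>j=1..r. (cos (\<theta> j))\<^sup>2))) \<partial>lborel)"
    if rank: "rank B = r"
    unfolding U_comp_def score_risk_def
  proof (intro mult_left_mono nn_integral_mono)
    fix t
    show "(\<integral>\<^sup>+x. ennreal ((norm (s_comp \<sigma>2 p2z A2 V1 x t - grad (\<lambda>u. ln (fwd_density p2 t u)) x))\<^sup>2) \<partial>fwd_law p2 t)
         * indicator {t0..T} t \<le> ennreal (
            lam t / (fwd_h t)\<^sup>2 * (real CARD('d2) - (\<Sum>j=1..r. (cos (\<theta> j))\<^sup>2))
          + 2 * (op_norm B)\<^sup>2 * (Lg t)\<^sup>2 / (fwd_h t)\<^sup>2 * trace ((mat 1 - pinv B ** B) ** MY t)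
          + 2 * (op_norm B)\<^sup>2 * htilde \<sigma>2 t * (Lg t)\<^sup>2 / (fwd_h t)\<^sup>2 * (\<Sum>j=1..r. (tan (\<theta> j))\<^sup>2)
          + \<sigma>2 ^ 4 * (fwd_alpha t) ^ 4 / ((fwd_h t)\<^sup>2 * htilde \<sigma>2 t)
              * (real CARD('D) + real CARD('d1) - real CARD('d2) - (\<Sum>j=1..r. (cos (\<theta> j))\<^sup>2))) * indicator {t0..T} t"
    \<comment> \<open>The comparison is pointwise in time. Inside the interval \<open>t0 > 0\<close>
      makes \<open>t\<close> positive and \<open>Lg\<close> applies; outside both integrands are
      0.\<close>
    proof (cases "t \<in> {t0..T}")
      case True
      then have "comparator_model p2z A2 \<sigma>2 p2 V1 t (Lg t)"
        using model V1 Lg[OF True] times by (simp add: comparator_model_def comparator_model_axioms_def)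
      from comparator_model.risk_le[OF this sys[unfolded B] rank[unfolded B]] show ?thesis
        unfolding lam MY tan[OF rank, symmetric] B by (rule mult_right_mono) simp
    qed simp
  qed simp
  show ?thesis
  proof (intro conjI impI)
    assume *: "CARD('d2) \<le> CARD('d1) \<and> rank B = CARD('d2)"
    then have r: "r = CARD('d2)" and rank: "rank B = r" by (simp_all add: r_def)
    \<comment> \<open>With full column rank B has no kernel, so the projection in the trace term is
      0 and the first regime shows no such term.\<close>
    have "inj ((*v) B)" using * by (simp add: full_rank_injective)
    moreover have "B *v ((pinv B ** B) *v x) = B *v x" for x
      using S.pinv_mult(2)[OF rank] by (simp add: is_pinv_def matrix_vector_mul_assoc matrix_mul_assoc)
    ultimately have "(pinv B ** B) *v x = mat 1 *v x" for x by (metis injD matrix_vector_mul_lid)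
    then have PB: "pinv B ** B = mat 1" by (simp add: matrix_eq)
    have tr: "trace ((mat 1 - pinv B ** B) ** MY t) = 0" for t
      unfolding PB diff_self by (simp add: trace_def matrix_matrix_mult_def)
    have sin: "real CARD('d2) - (\<Sum>j=1..CARD('d2). (cos (\<theta> j))\<^sup>2) = (\<Sum>j=1..CARD('d2). (sin (\<theta> j))\<^sup>2)"
      by (simp add: sin_squared_eq sum_subtractf)
    show "U_comp p2 t0 T \<sigma>2 p2z A2 V1 \<le>
        ennreal (1 / (T - t0)) *
        (\<integral>\<^sup>+t\<in>{t0..T}. ennreal (
            lam t / (fwd_h t)\<^sup>2 * (\<Sum>j=1..CARD('d2). (sin (\<theta> j))\<^sup>2)
          + 2 * (op_norm B)\<^sup>2 * htilde \<sigma>2 t * (Lg t)\<^sup>2 / (fwd_h t)\<^sup>2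
              * (\<Sum>j=1..CARD('d2). (tan (\<theta> j))\<^sup>2)
          + \<sigma>2 ^ 4 * (fwd_alpha t) ^ 4 / ((fwd_h t)\<^sup>2 * htilde \<sigma>2 t)
              * (real CARD('D) + real CARD('d1) - real CARD('d2)
                  - (\<Sum>j=1..CARD('d2). (cos (\<theta> j))\<^sup>2))) \<partial>lborel)"
      using risk[OF rank] unfolding r tr sin mult_zero_right add_0_right .
  next
    assume "CARD('d1) < CARD('d2) \<and> rank B = CARD('d1)"
    then have r: "r = CARD('d1)" and rank: "rank B = r" by (simp_all add: r_def)
    show "U_comp p2 t0 T \<sigma>2 p2z A2 V1 \<le>
        ennreal (1 / (T - t0)) *
        (\<integral>\<^sup>+t\<in>{t0..T}. ennreal (
            lam t / (fwd_h t)\<^sup>2 * (real CARD('d2) - (\<Sum>j=1..CARD('d1). (cos (\<theta> j))\<^sup>2))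
          + 2 * (op_norm B)\<^sup>2 * (Lg t)\<^sup>2 / (fwd_h t)\<^sup>2
              * trace ((mat 1 - pinv B ** B) ** MY t)
          + 2 * (op_norm B)\<^sup>2 * htilde \<sigma>2 t * (Lg t)\<^sup>2 / (fwd_h t)\<^sup>2
              * (\<Sum>j=1..CARD('d1). (tan (\<theta> j))\<^sup>2)
          + \<sigma>2 ^ 4 * (fwd_alpha t) ^ 4 / ((fwd_h t)\<^sup>2 * htilde \<sigma>2 t)
              * (real CARD('D) + real CARD('d1) - real CARD('d2)
                  - (\<Sum>j=1..CARD('d1). (cos (\<theta> j))\<^sup>2))) \<partial>lborel)"
      using risk[OF rank] unfolding r .
  qed
qed

end
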